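(* Let $N\ge 2$ be an integer. For $k>0$ let $X_k$ be a $C_N^A$-valued random variable with density $f_k$, and let $\tilde X_k:=\phi_k(X_k)$. Then the $\mathbb R^N$-valued rescaled random variables $\tilde X_k$ converge in distribution for $k\to\infty$ to some probability measure $\mu$ on $\mathbb R^N$ with support $B_N=\{y\in\mathbb R^N:\ \langle y,\mathbf z\rangle\ge 0\}$. The measure $\mu$ has the Lebesgue density $$ f(y)=\frac{\sqrt{N!}\,(N(N-1))^{N/2}\,e^{N(N-1)}}{\pi^{N/2}\,2^{(N-1)/2}}\exp\Biggl(-\frac{\|\mathbf z\|^2}{\|p_{\mathbf z}(y)\|^2}\Biggl(\sum_{1\le i<j\le N}\frac{(y_i-y_j)^2}{(z_i-z_j)^2}+\|y\|^2\Biggr)\Biggr)\exp\Biggl(\frac{-N(N-1)}{2\|p_{\mathbf z}(y)\|^2}\Biggr)\frac{1}{\|p_{\mathbf z}(y)\|^{N+1}} $$ for $y$ in the interior of the half space $B_N$.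
   Context: $C_N^A:=\{x\in\mathbb R^N:\ x_1\ge x_2\ge\dots\ge x_N\}$ is the closed Weyl chamber of type $A_{N-1}$. For $k\ge 0$, $f_k$ is the probability density (with respect to Lebesgue measure) on $C_N^A$ given by $$f_k(y)=C(k,N)\,\frac{1}{(1+\|y\|^2)^{kN(N-1)/2+(N+1)/2}}\prod_{1\le i<j\le N}(y_i-y_j)^{2k},$$ with the norming constant $$C(k,N)=\frac{2^{kN(N-1)/2}\,N!\,\Gamma(kN(N-1)/2+(N+1)/2)}{\pi^{(N+1)/2}}\prod_{j=1}^N\frac{\Gamma(1+k)}{\Gamma(1+jk)}.$$ $\mathbf z=(z_1,\dots,z_N)\in C_N^A$ is the vector of the ordered zeros $z_1>\dots>z_N$ of the classical (physicists') Hermite polynomial $H_N$, where $H_0=1$, $H_1(x)=2x$, $H_{n+1}(x)=2xH_n(x)-2nH_{n-1}(x)$ for $n\ge1$ (orthogonal with respect to $e^{-x^2}$ on $\mathbb R$). $\langle\cdot,\cdot\rangle$ and $\|\cdot\|$ are the Euclidean inner product and norm on $\mathbb R^N$. $p_{\mathbf z}(y)=\frac{\langle y,\mathbf z\rangle}{\|\mathbf z\|^2}\mathbf z$ is the orthogonal projection onto $\mathbb R\cdot\mathbf z$, and $p_{\mathbf z^\perp}(y)=y-p_{\mathbf z}(y)$ is the orthogonal projection onto $\mathbf z^\perp$. The rescaling maps are the linear maps $$\phi_k:\mathbb R^N\to\mathbb R^N,\qquad \phi_k(y)=\frac1{\sqrt k}\,p_{\mathbf z}(y)+p_{\mathbf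 z^\perp}(y).$$ *)

theory Defs
  imports "HOL-Probability.Probability" "HOL-Computational_Algebra.Polynomial"
begin

text \<open>
  Vectors of \<open>\<real>\<^sup>N\<close> have type \<open>real ^ 'n\<close> with \<open>'n\<close> a finite linearly ordered type and
  \<open>N = CARD('n)\<close>; the order of \<open>'n\<close> plays the role of the order of the index set \<open>{1,\<dots>,N}\<close>.
\<close>

definition weyl_chamber :: "(real ^ 'n::{finite,linorder}) set" where
  "weyl_chamber = {x. \<forall>i j. i \<le> j \<longrightarrow> x $ j \<le> x $ i}"

definition norming_const :: "real \<Rightarrow> nat \<Rightarrow> real" where
  "norming_const k N =
     2 powr (k * real N * (real N - 1) / 2) * fact N
       * Gamma (k * real N * (real N - 1) / 2 + (real N + 1) / 2) / pi powr ((real N + 1) / 2)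
       * (\<Prod>j=1..N. Gamma (1 + k) / Gamma (1 + real j * k))"

text \<open>
  The formula is only meaningful on the Weyl chamber, where all bases of \<open>powr\<close> in the product
  are nonnegative.
\<close>

definition beta_density :: "real \<Rightarrow> real ^ 'n::{finite,linorder} \<Rightarrow> real" where
  "beta_density k y =
     norming_const k CARD('n)
       * (1 / (1 + (norm y)\<^sup>2)
            powr (k * real CARD('n) * (real CARD('n) - 1) / 2 + (real CARD('n) + 1) / 2))
       * (\<Prod>(i, j)\<in>{(i, j). i < j}. (y $ i - y $ j) powr (2 * k))"

text \<open>The physicists' Hermite polynomials, orthogonal with respect to \<open>exp (- x\<^sup>2)\<close>.\<close>

fun hermite :: "nat \<Rightarrow> real poly" where
  "hermite 0 = 1"
| "hermite (Suc 0) = [:0, 2:]"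
| "hermite (Suc (Suc n)) =
     [:0, 2:] * hermite (Suc n) - smult (2 * real (Suc n)) (hermite n)"

definition ordered_hermite_zeros :: "real ^ 'n::{finite,linorder} \<Rightarrow> bool" where
  "ordered_hermite_zeros z \<longleftrightarrow>
     (\<forall>i j. i < j \<longrightarrow> z $ j < z $ i) \<and> range (($) z) = {x. poly (hermite CARD('n)) x = 0}"

definition proj_line :: "'a::real_inner \<Rightarrow> 'a \<Rightarrow> 'a" where
  "proj_line z y = ((y \<bullet> z) / (norm z)\<^sup>2) *\<^sub>R z"

definition proj_perp :: "'a::real_inner \<Rightarrow> 'a \<Rightarrow> 'a" where
  "proj_perp z y = y - proj_line z y"

definition rescaling :: "'a::real_inner \<Rightarrow> real \<Rightarrow> 'a \<Rightarrow> 'a" where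
  "rescaling z k y = (1 / sqrt k) *\<^sub>R proj_line z y + proj_perp z y"

definition half_space :: "'a::real_inner \<Rightarrow> 'a set" where
  "half_space z = {y. y \<bullet> z \<ge> 0}"

definition limit_density ::
  "real ^ 'n::{finite,linorder} \<Rightarrow> real ^ 'n::{finite,linorder} \<Rightarrow> real" where
  "limit_density z y = (let N = CARD('n); p = norm (proj_line z y) in
     sqrt (fact N) * (real N * (real N - 1)) powr (real N / 2) * exp (real N * (real N - 1))
       / (pi powr (real N / 2) * 2 powr ((real N - 1) / 2))
     * exp (- ((norm z)\<^sup>2 / p\<^sup>2)
              * ((\<Sum>(i, j)\<in>{(i, j). i < j}. (y $ i - y $ j)\<^sup>2 / (z $ i - z $ j)\<^sup>2)
                 + (norm y)\<^sup>2))
     * exp (- (real N * (real N - 1)) / (2 * p\<^sup>2))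
     * (1 / p ^ (N + 1)))"

text \<open>
  Convergence in distribution on a general topological space, along a filter; the library's
  \<open>weak_conv\<close> and \<open>weak_conv_m\<close> cover only sequences of measures on the real line. The random
  variables may live on different probability spaces \<open>M k\<close>.
\<close>

definition converges_in_distribution ::
  "('i \<Rightarrow> 'w measure) \<Rightarrow> ('i \<Rightarrow> 'w \<Rightarrow> 'a::topological_space) \<Rightarrow> 'a measure \<Rightarrow> 'i filter \<Rightarrow> bool"
where
  "converges_in_distribution M X \<mu> F \<longleftrightarrow>
     (\<forall>g :: 'a \<Rightarrow> real. continuous_on UNIV g \<longrightarrow> bounded (range g) \<longrightarrow>
        ((\<lambda>k. integral\<^sup>L (distr (M k) borel (X k)) g) \<longlongrightarrow> integral\<^sup>L \<mu> g) F)"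

definition topological_support :: "'a::topological_space measure \<Rightarrow> 'a set" where
  "topological_support \<mu> = {x. \<forall>U. open U \<longrightarrow> x \<in> U \<longrightarrow> emeasure \<mu> U > 0}"

end

theory Submission
  imports Defs "HOL-Computational_Algebra.Fundamental_Theorem_Algebra" "HOL-Real_Asymp.Real_Asymp"
begin

text \<open>
  Write \<open>x = a z + w\<close> with \<open>w\<close> orthogonal to \<open>z\<close>. The rescaled variable has density
  \<open>\<surd>k f\<^sub>k (\<surd>k a z + w)\<close>, supported where \<open>a > 0\<close>, and its root factor is the product of
  \<open>((\<surd>k a (z\<^sub>i - z\<^sub>j)) (1 + u\<^sub>i\<^sub>j / \<surd>k)) powr 2k\<close> with \<open>u\<^sub>i\<^sub>j = (w\<^sub>i - w\<^sub>j) / (a (z\<^sub>i - z\<^sub>j))\<close>.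
  Stieltjes' relation \<open>\<Sum>\<^sub>j 1 / (z\<^sub>i - z\<^sub>j) = z\<^sub>i\<close>, a consequence of the Hermite differential equation, makes the sum
  of the \<open>u\<^sub>i\<^sub>j\<close> vanish, so that the product of the \<open>(1 + u\<^sub>i\<^sub>j / \<surd>k) powr 2k\<close> is at most \<open>1\<close> and tends to
  \<open>exp (- \<Sum> u\<^sub>i\<^sub>j\<^sup>2)\<close>. The constants converge by Stirling's formula and Schur's evaluation of the
  discriminant of \<open>H\<^sub>N\<close>. All densities are dominated by a multiple of the integrable function
  \<open>(1 + \<parallel>x\<parallel>\<^sup>2) powr - (N + 1) / 2\<close>, and dominated convergence also gives the total mass \<open>1\<close> of the
  limit, without Selberg's integral.
\<close>

section \<open>Hermite polynomials and their zeros\<close>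

text \<open>Expanding \<open>2 * k * ln (1 + u / sqrt k)\<close> gives a linear term of order
  \<open>sqrt k\<close>, which would diverge, and a quadratic term that survives. Stieltjes'
  relation says that \<open>z\<close> is a critical point of the root product on its sphere, and
  this is why the linear terms cancel over all pairs when vectors are compared with multiples of
  \<open>z\<close>. The root product at \<open>z\<close> itself enters with the power
  \<open>2 * k\<close>, and Stirling's formula leaves further factors exponential in
  \<open>k\<close>. They have to cancel exactly, so the discriminant is needed as a number and not
  merely as a nonzero quantity. A majorant must hold uniformly in \<open>k\<close>, up to the wall
  of the chamber, where an expansion of the logarithm is useless. There
  \<open>1 + v <= exp v\<close> turns the cancellation of the linear terms into an inequality valid
  for every \<open>k\<close>. The mass 1 before the limit comes from the hypothesis that
  \<open>beta_density k\<close> is the density of a random variable on a probability space.\<close>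

lemma degree_hermite: "degree (hermite n) = n"
  and coeff_hermite_self: "coeff (hermite n) n = 2 ^ n"
proof -
  have *: "coeff (hermite n) n = 2 ^ n \<and> (\<forall>m>n. coeff (hermite n) m = 0)" for n
  proof (induction n rule: hermite.induct)
    case 1 show ?case by (auto simp: coeff_eq_0)
  next
    case 2 show ?case by (auto simp: coeff_pCons split: nat.splits)
  next
    case (3 n) then show ?case by (auto simp: coeff_pCons split: nat.splits)
  qed
  show c: "coeff (hermite n) n = 2 ^ n" using * by blast
  have "degree (hermite n) \<le> n" using * by (intro degree_le) blast
  moreover have "n \<le> degree (hermite n)" using c by (intro le_degree) auto
  ultimately show "degree (hermite n) = n" by simp
qed

lemma pderiv_hermite: "pderiv (hermite (Suc n)) = smult (2 * real (Suc n)) (hermite n)"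
proof (induction n rule: hermite.induct)
  case 1 show ?case by (simp add: pderiv_pCons)
next
  case 2 show ?case by (simp add: pderiv_pCons pderiv_diff pderiv_mult pderiv_smult one_pCons)
next
  case (3 n)
  have "pderiv (hermite (Suc (Suc (Suc n)))) =
        smult 2 (hermite (Suc (Suc n))) + [:0,2:] * smult (2 * real (Suc (Suc n))) (hermite (Suc n))
        - smult (2 * real (Suc (Suc n))) (smult (2 * real (Suc n)) (hermite n))"
    by (simp only: hermite.simps(3)[of "Suc n"] pderiv_diff pderiv_mult pderiv_smult "3.IH")
       (simp add: pderiv_pCons)
  also have "\<dots> = smult 2 (hermite (Suc (Suc n))) + smult (2 * real (Suc (Suc n)))
       ([:0,2:] * hermite (Suc n) - smult (2 * real (Suc n)) (hermite n))"
    by (simp only: smult_diff_right mult_smult_right add_diff_eq)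
  also have "\<dots> = smult (2 + 2 * real (Suc (Suc n))) (hermite (Suc (Suc n)))"
    by (simp only: hermite.simps(3)[of n] smult_add_left)
  finally show ?case by (simp add: algebra_simps)
qed

text \<open>At a root the term with \<open>H_n\<close> drops out of the Hermite equation. The
  three-term recurrence then links the two lower polynomials, and these are \<open>H_n'\<close> and
  \<open>H_n''\<close> up to constants.\<close>

lemma hermite_ode_at_root:
  assumes "poly (hermite n) x = 0"
  shows "poly (pderiv (pderiv (hermite n))) x = 2 * x * poly (pderiv (hermite n)) x"
proof (cases n rule: hermite.cases)
  case 1 with assms show ?thesis by simp
next
  case 2 with assms show ?thesis by (simp add: pderiv_pCons)
next
  case (3 m)
  have "2 * x * poly (hermite (Suc m)) x = 2 * real (Suc m) * poly (hermite m) x"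
    using assms by (simp add: 3)
  then show ?thesis
    by (simp add: 3 pderiv_hermite pderiv_smult del: hermite.simps)
qed

text \<open>Norms absorb the sign in the symmetry of the resultant.\<close>

lemma norm_prod_mset_roots_symmetric:
  fixes A B :: "complex multiset"
  shows "norm (\<Prod>a\<in>#A. poly (smult c (\<Prod>b\<in>#B. [:- b, 1:])) a) * norm d ^ size B =
         norm (\<Prod>b\<in>#B. poly (smult d (\<Prod>a\<in>#A. [:- a, 1:])) b) * norm c ^ size A"
proof -
  have e: "norm (\<Prod>a\<in>#A. poly (smult c (\<Prod>b\<in>#B. [:- b, 1:])) a) =
        norm c ^ size A * (\<Prod>a\<in>#A. \<Prod>b\<in>#B. norm (a - b))" for c :: complex and A B
  proof -
    have n: "norm (prod_mset (image_mset f M)) = prod_mset (image_mset (\<lambda>x. norm (f x)) M)"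
      for f :: "complex \<Rightarrow> complex" and M
      by (induction M) (simp_all add: norm_mult)
    have p: "poly (\<Prod>b\<in>#B. [:- b, 1:]) a = (\<Prod>b\<in>#B. a - b)" for a
      by (induction B) (simp_all add: algebra_simps)
    have "(\<Prod>a\<in>#A. norm c * f a) = norm c ^ size A * prod_mset (image_mset f A)" for f :: "complex \<Rightarrow> real"
      by (induction A) simp_all
    then show ?thesis by (simp add: n p norm_mult)
  qed
  have s: "(\<Prod>b\<in>#B. \<Prod>a\<in>#A. norm (b - a)) = (\<Prod>a\<in>#A. \<Prod>b\<in>#B. norm (a - b))"
  proof (induction A)
    case empty then show ?case by (induction B) auto
  next
    case (add x A)
    then show ?case by (simp add: prod_mset.distrib norm_minus_commute)
  qed
  show ?thesis unfolding e s by (simp only: mult_ac)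
qed

text \<open>Distinct real zeros are given only in degree N, whereas the resultant recursion passes
  through all lower degrees. Complex roots with multiplicity are available in every degree.\<close>

definition hermite_roots :: "nat \<Rightarrow> complex multiset" where
  "hermite_roots n = proots (map_poly of_real (hermite n))"

lemma coeff_of_real_poly: "coeff (map_poly of_real p) n = (of_real (coeff p n) :: complex)"
  by (simp add: coeff_map_poly)

lemma poly_of_real:
  "poly (map_poly of_real p) (of_real x) = (of_real (poly p x) :: 'a :: {real_algebra_1, comm_ring_1})"
  by (induction p) (simp_all add: map_poly_pCons)

lemma proots_linear_factors:
  fixes A :: "'a::idom multiset"
  shows "proots (\<Prod>x\<in>#A. [:-x, 1:]) = A"
proof (induction A)
  case empty show ?case by simp
next
  case (add x A)
  have "(\<Prod>x\<in>#A. [:-x, 1:]) \<noteq> 0" by (auto simp: prod_mset_zero_iff)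
  then have "proots ([:-x, 1:] * (\<Prod>x\<in>#A. [:-x, 1:])) = {#x#} + A"
    by (subst proots_mult) (auto simp: add.IH)
  then show ?case by simp
qed

lemma complex_hermite_factorization:
  "map_poly of_real (hermite n) = smult (2 ^ n) (\<Prod>a\<in>#hermite_roots n. [:- a, 1:] :: complex poly)"
proof -
  let ?h = "map_poly of_real (hermite n) :: complex poly"
  have d: "degree ?h = n" by (subst degree_map_poly) (auto simp: degree_hermite)
  have h0: "?h \<noteq> 0" using coeff_hermite_self[of n] by (metis coeff_0 coeff_of_real_poly of_real_eq_0_iff power_not_zero zero_neq_numeral)
  have lc: "lead_coeff ?h = 2 ^ n" by (simp add: d coeff_of_real_poly coeff_hermite_self)
  obtain A where A: "size A = degree ?h" "?h = smult (lead_coeff ?h) (\<Prod>x\<in>#A. [:-x, 1:])"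
    using alg_closed_imp_factorization[OF h0] by blast
  have "proots ?h = A"
    using A lc proots_linear_factors[of A] by (metis h0 leading_coeff_0_iff proots_smult)
  then show ?thesis using A(2) lc by (simp add: hermite_roots_def)
qed

lemma size_hermite_roots: "size (hermite_roots n) = n"
  unfolding hermite_roots_def size_proots_complex by (subst degree_map_poly) (auto simp: degree_hermite)

lemma poly_of_real_hermite_rec:
  fixes x :: complex
  shows "poly (map_poly of_real (hermite (Suc (Suc n)))) x =
     2 * x * poly (map_poly of_real (hermite (Suc n))) x
     - 2 * of_nat (Suc n) * poly (map_poly of_real (hermite n)) x"
proof -
  have "map_poly of_real (hermite (Suc (Suc n))) =
     [:0, 2:] * map_poly of_real (hermite (Suc n))
      - smult (2 * of_nat (Suc n)) (map_poly of_real (hermite n) :: complex poly)"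
    by (rule poly_eqI) (simp add: coeff_of_real_poly coeff_pCons split: nat.splits)
  then show ?thesis by simp
qed

text \<open>Schur's recursion for the resultant of consecutive Hermite polynomials: exchange the two
  polynomials by symmetry, then reduce \<open>H_(n+2)\<close> at the roots of \<open>H_(n+1)\<close>
  by the recurrence. Each of the \<open>n + 1\<close> roots contributes a factor
  \<open>2 * (n + 1)\<close> in absolute value.\<close>

lemma norm_prod_hermite_consecutive:
  "norm (\<Prod>a\<in>#hermite_roots (Suc n). poly (map_poly of_real (hermite n)) a)
     = (\<Prod>j=1..n. (2 * real j) ^ j)"
proof (induction n)
  case 0
  then show ?case by (simp add: prod_mset_constant)
next
  case (Suc n)
  let ?h = "\<lambda>n. map_poly of_real (hermite n) :: complex poly"
  let ?R = hermite_roots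
  have "norm (\<Prod>a\<in>#?R (Suc (Suc n)). poly (?h (Suc n)) a) * norm ((2::complex) ^ Suc (Suc n)) ^ (Suc n)
     = norm (\<Prod>b\<in>#?R (Suc n). poly (?h (Suc (Suc n))) b) * norm ((2::complex) ^ Suc n) ^ (Suc (Suc n))"
    using norm_prod_mset_roots_symmetric[of "2 ^ Suc n" "?R (Suc n)" "?R (Suc (Suc n))" "2 ^ Suc (Suc n)"]
    by (simp only: complex_hermite_factorization[symmetric] size_hermite_roots)
  \<comment> \<open>The powers of the leading coefficients are both 2 to the power
    \<open>(n + 1) * (n + 2)\<close>, so they cancel.\<close>
  moreover have "norm ((2::complex) ^ Suc n) ^ (Suc (Suc n)) = norm ((2::complex) ^ Suc (Suc n)) ^ (Suc n)"
    unfolding norm_power by (simp only: power_mult[symmetric] mult.commute)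
  ultimately have "norm (\<Prod>a\<in>#?R (Suc (Suc n)). poly (?h (Suc n)) a)
     = norm (\<Prod>b\<in>#?R (Suc n). poly (?h (Suc (Suc n))) b)"
    by auto
  also have "(\<Prod>b\<in>#?R (Suc n). poly (?h (Suc (Suc n))) b) = (\<Prod>b\<in>#?R (Suc n). (- 2 * of_nat (Suc n)) * poly (?h n) b)"
  proof (intro arg_cong[where f = prod_mset] image_mset_cong)
    fix b assume "b \<in># ?R (Suc n)"
    then have "poly (?h (Suc n)) b = 0"
      by (cases "?h (Suc n) = 0") (auto simp: hermite_roots_def simp del: hermite.simps)
    then show "poly (?h (Suc (Suc n))) b = (- 2 * of_nat (Suc n)) * poly (?h n) b"
      unfolding poly_of_real_hermite_rec by (simp add: algebra_simps)
  qed
  also have "\<dots> = (- 2 * of_nat (Suc n)) ^ Suc n * (\<Prod>b\<in>#?R (Suc n). poly (?h n) b)"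
  proof -
    have "(\<Prod>b\<in>#A. c * f b) = c ^ size A * (\<Prod>b\<in>#A. f b)" for c :: complex and f :: "complex \<Rightarrow> complex" and A
      by (induction A) simp_all
    then show ?thesis by (simp only: size_hermite_roots)
  qed
  finally show ?case
    unfolding norm_mult Suc.IH
    by (simp add: norm_mult norm_power mult.commute del: of_nat_Suc power_Suc)
qed

section \<open>Identities for the ordered zeros: Stieltjes' relation, norm, discriminant\<close>

locale hermite_zeros =
  fixes z :: "real ^ 'n::{finite,linorder}"
  assumes zeros: "ordered_hermite_zeros z"
begin


lemma zeros_strict: "i < j \<Longrightarrow> z $ j < z $ i"
  using zeros by (auto simp: ordered_hermite_zeros_def)

lemma zeros_eq_iff: "z $ i = z $ j \<longleftrightarrow> i = j"
  using zeros_strict[of i j] zeros_strict[of j i] by (cases i j rule: linorder_cases) auto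

lemma inj_zeros: "inj (($) z)"
  by (auto simp: inj_def zeros_eq_iff)

lemma hermite_at_zero: "poly (hermite CARD('n)) (z $ i) = 0"
  using zeros unfolding ordered_hermite_zeros_def by blast

lemma hermite_factorization: "hermite CARD('n) = smult (2 ^ CARD('n)) (\<Prod>i\<in>UNIV. [:- (z $ i), 1:])"
proof (rule poly_eqI_degree_lead_coeff)
  have c: "card (range (($) z)) = CARD('n)" by (simp add: card_image inj_zeros)
  show "CARD('n) \<le> card (range (($) z))" by (simp add: c)
  have d: "degree (\<Prod>i\<in>UNIV. [:- (z $ i), 1:]) = CARD('n)"
    by (subst degree_prod_eq_sum_degree) auto
  show "degree (smult (2 ^ CARD('n)) (\<Prod>i\<in>UNIV. [:- (z $ i), 1:])) \<le> CARD('n)" by (simp add: d)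
  have "lead_coeff (\<Prod>i\<in>UNIV. [:- (z $ i), 1:]) = 1"
    by (subst lead_coeff_prod) simp
  then show "coeff (hermite CARD('n)) CARD('n) = coeff (smult (2 ^ CARD('n)) (\<Prod>i\<in>UNIV. [:- (z $ i), 1:])) CARD('n)"
    by (simp add: d coeff_hermite_self)
  show "degree (hermite CARD('n)) \<le> CARD('n)" by (simp add: degree_hermite)
  show "poly (hermite CARD('n)) x = poly (smult (2 ^ CARD('n)) (\<Prod>i\<in>UNIV. [:- (z $ i), 1:])) x"
    if "x \<in> range (($) z)" for x
    using that hermite_at_zero by (auto simp: poly_prod)
qed

text \<open>With \<open>H = 2 ^ N * (X - z_i) * Q\<close> the derivatives at \<open>z_i\<close> are
  \<open>2 ^ N * Q\<close> and \<open>2 * 2 ^ N * Q'\<close>; the sum of reciprocals is the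
  logarithmic derivative of \<open>Q\<close>.\<close>

lemma hermite_derivs_at_zero:
  "poly (pderiv (hermite CARD('n))) (z $ i) = 2 ^ CARD('n) * (\<Prod>j\<in>-{i}. z $ i - z $ j)"
  "poly (pderiv (pderiv (hermite CARD('n)))) (z $ i) =
     2 * poly (pderiv (hermite CARD('n))) (z $ i) * (\<Sum>j\<in>-{i}. 1 / (z $ i - z $ j))"
proof -
  define Q where "Q = (\<Prod>j\<in>-{i}. [:- (z $ j), 1:])"
  have "(\<Prod>j\<in>UNIV. [:- (z $ j), 1:]) = [:- (z $ i), 1:] * Q"
    unfolding Q_def using prod.remove[of UNIV i "\<lambda>j. [:- (z $ j), 1:]"] by (simp add: Compl_eq_Diff_UNIV)
  then have H: "hermite CARD('n) = smult (2 ^ CARD('n)) ([:- (z $ i), 1:] * Q)"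
    using hermite_factorization by simp
  have pd: "pderiv (hermite CARD('n)) = smult (2 ^ CARD('n)) (Q + [:- (z $ i), 1:] * pderiv Q)"
    unfolding H pderiv_smult pderiv_mult by (simp add: pderiv_pCons add.commute)
  have pd2: "pderiv (pderiv (hermite CARD('n))) =
      smult (2 ^ CARD('n)) (pderiv Q + pderiv Q + [:- (z $ i), 1:] * pderiv (pderiv Q))"
    unfolding pd pderiv_smult pderiv_mult pderiv_add
    by (simp add: pderiv_pCons algebra_simps)
  have "poly Q (z $ i) = (\<Prod>j\<in>-{i}. z $ i - z $ j)" by (simp add: Q_def poly_prod)
  then show d1: "poly (pderiv (hermite CARD('n))) (z $ i) = 2 ^ CARD('n) * (\<Prod>j\<in>-{i}. z $ i - z $ j)"
    unfolding pd by simp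
  have "poly (pderiv Q) (z $ i) = (\<Sum>j\<in>-{i}. \<Prod>l\<in>-{i}-{j}. z $ i - z $ l)"
    by (simp add: Q_def pderiv_prod poly_sum poly_prod pderiv_pCons)
  also have "\<dots> = (\<Sum>j\<in>-{i}. (\<Prod>l\<in>-{i}. z $ i - z $ l) * (1 / (z $ i - z $ j)))"
  proof (intro sum.cong refl)
    fix j assume j: "j \<in> -{i}"
    have "(\<Prod>l\<in>-{i}. z $ i - z $ l) = (z $ i - z $ j) * (\<Prod>l\<in>-{i}-{j}. z $ i - z $ l)"
      using j by (subst prod.remove[of _ j]) auto
    then show "(\<Prod>l\<in>-{i}-{j}. z $ i - z $ l) = (\<Prod>l\<in>-{i}. z $ i - z $ l) * (1 / (z $ i - z $ j))"
      using j zeros_eq_iff[of i j] by auto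
  qed
  finally show "poly (pderiv (pderiv (hermite CARD('n)))) (z $ i) =
     2 * poly (pderiv (hermite CARD('n))) (z $ i) * (\<Sum>j\<in>-{i}. 1 / (z $ i - z $ j))"
    unfolding d1 unfolding pd2
    by (simp add: sum_distrib_left mult_ac)
qed

text \<open>The differential equation and the factorization give two values of \<open>H''\<close> at
  \<open>z_i\<close>. Since the zeros are distinct, \<open>H'\<close> does not vanish there and can
  be cancelled.\<close>

lemma stieltjes_relation: "(\<Sum>j\<in>-{i}. 1 / (z $ i - z $ j)) = z $ i"
proof -
  have "poly (pderiv (hermite CARD('n))) (z $ i) \<noteq> 0"
    unfolding hermite_derivs_at_zero(1) using zeros_eq_iff[of i] by auto
  with hermite_derivs_at_zero(2)[of i] hermite_ode_at_root[OF hermite_at_zero[of i]]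
  show ?thesis by simp
qed

abbreviation pairs :: "('n \<times> 'n) set" where
  "pairs \<equiv> {(i, j). i < j}"

lemma offdiag_split: "(SIGMA i:UNIV. -{i}) = pairs \<union> prod.swap ` pairs"
  by (auto simp: image_iff)

lemma sum_offdiag:
  fixes f :: "'n \<Rightarrow> 'n \<Rightarrow> real"
  shows "(\<Sum>i\<in>UNIV. \<Sum>j\<in>-{i}. f i j) = (\<Sum>(i, j)\<in>pairs. f i j + f j i)"
proof -
  have "(\<Sum>i\<in>UNIV. \<Sum>j\<in>-{i}. f i j) = (\<Sum>(i, j)\<in>(SIGMA i:UNIV. -{i}). f i j)"
    by (subst sum.Sigma) auto
  also have "\<dots> = (\<Sum>(i, j)\<in>pairs. f i j) + (\<Sum>(i, j)\<in>prod.swap ` pairs. f i j)"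
    unfolding offdiag_split by (subst sum.union_disjoint) auto
  also have "(\<Sum>(i, j)\<in>prod.swap ` pairs. f i j) = (\<Sum>(i, j)\<in>pairs. f j i)"
    by (subst sum.reindex) (auto simp: o_def case_prod_unfold)
  finally show ?thesis by (simp add: sum.distrib case_prod_unfold)
qed

lemma prod_offdiag:
  fixes f :: "'n \<Rightarrow> 'n \<Rightarrow> real"
  shows "(\<Prod>i\<in>UNIV. \<Prod>j\<in>-{i}. f i j) = (\<Prod>(i, j)\<in>pairs. f i j * f j i)"
proof -
  have "(\<Prod>i\<in>UNIV. \<Prod>j\<in>-{i}. f i j) = (\<Prod>(i, j)\<in>(SIGMA i:UNIV. -{i}). f i j)"
    by (subst prod.Sigma) auto
  also have "\<dots> = (\<Prod>(i, j)\<in>pairs. f i j) * (\<Prod>(i, j)\<in>prod.swap ` pairs. f i j)"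
    unfolding offdiag_split by (subst prod.union_disjoint) auto
  also have "(\<Prod>(i, j)\<in>prod.swap ` pairs. f i j) = (\<Prod>(i, j)\<in>pairs. f j i)"
    by (subst prod.reindex) (auto simp: o_def case_prod_unfold)
  finally show ?thesis by (simp add: prod.distrib case_prod_unfold)
qed

text \<open>Stieltjes' relation summed against \<open>y\<close> and folded onto
  \<open>i < j\<close>. It is used for \<open>y = z\<close>, where every quotient is 1, for
  \<open>y\<close> orthogonal to \<open>z\<close>, where the linear terms cancel, and for
  \<open>y\<close> in the chamber, where all quotients are nonnegative.\<close>

lemma sum_difference_quotients: "(\<Sum>(i, j)\<in>pairs. (y $ i - y $ j) / (z $ i - z $ j)) = y \<bullet> z"
proof -
  have "y \<bullet> z = (\<Sum>i\<in>UNIV. \<Sum>j\<in>-{i}. y $ i / (z $ i - z $ j))"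
  proof -
    have "y \<bullet> z = (\<Sum>i\<in>UNIV. y $ i * (\<Sum>j\<in>-{i}. 1 / (z $ i - z $ j)))"
      by (simp only: inner_vec_def stieltjes_relation inner_real_def)
    then show ?thesis by (simp add: sum_distrib_left)
  qed
  also have "\<dots> = (\<Sum>(i, j)\<in>pairs. y $ i / (z $ i - z $ j) + y $ j / (z $ j - z $ i))"
    by (rule sum_offdiag)
  also have "\<dots> = (\<Sum>(i, j)\<in>pairs. (y $ i - y $ j) / (z $ i - z $ j))"
  proof (intro sum.cong refl, clarify)
    fix i j :: 'n assume "i < j"
    then have "z $ j < z $ i" by (rule zeros_strict)
    then show "y $ i / (z $ i - z $ j) + y $ j / (z $ j - z $ i) = (y $ i - y $ j) / (z $ i - z $ j)"
      by (simp add: divide_simps) (simp add: algebra_simps)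
  qed
  finally show ?thesis by simp
qed

lemma card_pairs: "2 * real (card pairs) = real CARD('n) * (real CARD('n) - 1)"
proof -
  have "2 * real (card pairs) = (\<Sum>i\<in>(UNIV :: 'n set). \<Sum>j\<in>-{i}. 1)"
    by (subst sum_offdiag) (simp add: case_prod_unfold)
  also have "\<dots> = real CARD('n) * (real CARD('n) - 1)"
    by (simp add: Compl_eq_Diff_UNIV card_Diff_singleton of_nat_diff Suc_leI)
  finally show ?thesis .
qed

lemma norm_zeros: "(norm z)\<^sup>2 = real CARD('n) * (real CARD('n) - 1) / 2"
proof -
  have "(norm z)\<^sup>2 = (\<Sum>(i, j)\<in>pairs. (z $ i - z $ j) / (z $ i - z $ j))"
    unfolding sum_difference_quotients by (simp only: power2_norm_eq_inner)
  also have "\<dots> = (\<Sum>(i, j)\<in>pairs. 1)"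
    using zeros_eq_iff by (intro sum.cong refl) auto
  finally show ?thesis using card_pairs by (simp add: case_prod_unfold)
qed

lemma hermite_roots_zeros: "hermite_roots CARD('n) = image_mset (\<lambda>i. of_real (z $ i)) (mset_set UNIV)"
proof -
  have "map_poly of_real (hermite CARD('n)) = smult (2 ^ CARD('n)) (\<Prod>i\<in>UNIV. [:- complex_of_real (z $ i), 1:])"
  proof (rule poly_eqI_degree_lead_coeff)
    let ?P = "\<Prod>i\<in>UNIV. [:- complex_of_real (z $ i), 1:]"
    let ?A = "range (\<lambda>i. complex_of_real (z $ i))"
    show "CARD('n) \<le> card ?A" by (subst card_image) (auto simp: inj_def zeros_eq_iff)
    have d: "degree ?P = CARD('n)"
      by (subst degree_prod_eq_sum_degree) auto
    show "degree (smult (2 ^ CARD('n)) ?P) \<le> CARD('n)" by (simp add: d)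
    have "lead_coeff ?P = 1"
      by (subst lead_coeff_prod) simp
    then show "coeff (map_poly of_real (hermite CARD('n))) CARD('n) = coeff (smult (2 ^ CARD('n)) ?P) CARD('n)"
      by (simp add: d coeff_hermite_self coeff_of_real_poly)
    show "degree (map_poly complex_of_real (hermite CARD('n))) \<le> CARD('n)"
      by (subst degree_map_poly) (auto simp: degree_hermite)
    show "poly (map_poly of_real (hermite CARD('n))) x = poly (smult (2 ^ CARD('n)) ?P) x" if "x \<in> ?A" for x
      using that hermite_at_zero by (auto simp: poly_prod poly_of_real)
  qed
  also have "(\<Prod>i\<in>UNIV. [:- complex_of_real (z $ i), 1:])
     = (\<Prod>a\<in>#image_mset (\<lambda>i. of_real (z $ i)) (mset_set UNIV). [:- a, 1:])"
    by (simp add: prod_unfold_prod_mset image_mset.compositionality o_def)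
  finally show ?thesis
    by (simp add: hermite_roots_def proots_linear_factors)
qed

text \<open>The product of \<open>H'\<close> over the zeros is evaluated twice: by
  \<open>H' = 2 * N * H_(N-1)\<close> it is a resultant, and by the factorization it is the product
  of all differences. Absolute values remove the sign that arises when \<open>(i, j)\<close> and
  \<open>(j, i)\<close> are paired.\<close>

lemma discriminant:
  "2 ^ (CARD('n) * CARD('n)) * (\<Prod>(i, j)\<in>pairs. (z $ i - z $ j)\<^sup>2) = (\<Prod>j=1..CARD('n). (2 * real j) ^ j)"
proof -
  obtain m where m: "CARD('n) = Suc m" using not0_implies_Suc[of "CARD('n)"] by auto
  have "(\<Prod>a\<in>#hermite_roots (Suc m). poly (map_poly of_real (hermite m)) a)
     = of_real (\<Prod>i\<in>UNIV. poly (hermite m) (z $ i))"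
    unfolding m[symmetric] hermite_roots_zeros
    unfolding of_real_prod
    by (simp add: prod_unfold_prod_mset image_mset.compositionality o_def poly_of_real)
  then have 1: "\<bar>\<Prod>i\<in>UNIV. poly (hermite m) (z $ i)\<bar> = (\<Prod>j=1..m. (2 * real j) ^ j)"
    using norm_prod_hermite_consecutive[of m] by (simp only: norm_of_real)
  have "(\<Prod>i\<in>UNIV. poly (pderiv (hermite CARD('n))) (z $ i))
     = (\<Prod>i\<in>UNIV. (2 * real CARD('n)) * poly (hermite m) (z $ i))"
    by (simp add: m pderiv_hermite del: hermite.simps)
  \<comment> \<open>The constant \<open>2 * N\<close>, taken once for each zero, supplies the factor
    \<open>j = N\<close>; the resultant supplies those with \<open>j <= N - 1\<close>.\<close>
  also have "\<bar>\<dots>\<bar> = (\<Prod>j=1..CARD('n). (2 * real j) ^ j)"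
    unfolding prod.distrib abs_mult 1 by (simp add: m prod.atLeastAtMost_shift_bounds power_abs)
  also have "(\<Prod>i\<in>UNIV. poly (pderiv (hermite CARD('n))) (z $ i)) =
     2 ^ (CARD('n) * CARD('n)) * (\<Prod>i\<in>UNIV. \<Prod>j\<in>-{i}. z $ i - z $ j)"
    unfolding hermite_derivs_at_zero(1) prod.distrib by (simp add: power_mult)
  also have "(\<Prod>i\<in>UNIV. \<Prod>j\<in>-{i}. z $ i - z $ j) = (\<Prod>(i, j)\<in>pairs. (z $ i - z $ j) * (z $ j - z $ i))"
    by (rule prod_offdiag)
  finally show ?thesis
    by (simp add: abs_mult abs_prod case_prod_unfold power2_eq_square abs_minus_commute)
qed

end

section \<open>Stirling's formula for the Gamma function\<close>

text \<open>After division by \<open>x + 1/2\<close> the logarithm stands alone and the derivative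
  is rational. Each difference is strictly decreasing with limit 0 at infinity, hence positive. The
  upper bound is written as a difference so that it telescopes.\<close>

lemma ln_one_plus_inverse_bounds:
  fixes x :: real
  assumes "x > 0"
  shows "0 \<le> (x + 1/2) * ln (1 + 1 / x) - 1"
    and "(x + 1/2) * ln (1 + 1 / x) - 1 \<le> (1 / x - 1 / (x + 1)) / 12"
proof -
  have s: "1 / t - 1 / (t + 1) = 1 / (t * (t + 1))" "(t + 1/2)\<^sup>2 = t * (t + 1) + 1/4"
    "t * (t + 1) > 0" if "t > 0" for t :: real
  proof -
    show "t * (t + 1) > 0" using that by simp
  qed (use that in \<open>simp_all add: field_simps power2_eq_square\<close>)
  have ln: "ln (1 + 1 / x) = ln (x + 1) - ln x"
  proof -
    have "1 + 1 / x = (x + 1) / x" using assms by (simp add: field_simps)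
    then show ?thesis using assms by (simp add: ln_div)
  qed
  have lnD: "((\<lambda>t. ln (t + 1) - ln t) has_real_derivative (1 / (t + 1) - 1 / t)) (at t)" if "t > 0" for t :: real
    using that by (auto intro!: derivative_eq_intros)
  have quotD: "((\<lambda>t. f t / (t + 1/2)) has_real_derivative D / (t + 1/2) - f t / (t + 1/2)\<^sup>2) (at t)"
    if "t > 0" "(f has_real_derivative D) (at t)" for t D :: real and f
  proof -
    have r: "((\<lambda>t. t + 1/2) has_real_derivative 1) (at t)" by (auto intro!: derivative_eq_intros)
    have "t + 1/2 \<noteq> 0" using that by simp
    then have "(D * r - f t * 1) / (r * r) = D / r - f t / r\<^sup>2" if "r = t + 1/2" for r
      using that by (simp add: diff_divide_distrib power2_eq_square)
    then show ?thesis
      using DERIV_cong[OF DERIV_divide[OF that(2) r \<open>t + 1/2 \<noteq> 0\<close>]] by blast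
  qed
  have "0 < ln (x + 1) - ln x - 1 / (x + 1/2)"
  proof (rule DERIV_neg_imp_decreasing_at_top[where f = "\<lambda>t. ln (t + 1) - ln t - 1 / (t + 1/2)"])
    show "((\<lambda>t. ln (t + 1) - ln t - 1 / (t + 1/2)) \<longlongrightarrow> 0) (at_top :: real filter)" by real_asymp
    fix t assume "x \<le> t"
    then have t: "t > 0" using assms by simp
    have "((\<lambda>t. ln (t + 1) - ln t - 1 / (t + 1/2)) has_real_derivative
        (1 / (t + 1) - 1 / t + 1 / (t + 1/2)\<^sup>2)) (at t)"
      by (rule DERIV_cong[OF DERIV_diff[OF lnD[OF t] quotD[OF t DERIV_const]]]) simp
    moreover have "1 / (t + 1) - 1 / t + 1 / (t + 1/2)\<^sup>2 < 0"
    proof -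
      have "1 / (u + 1/4) < 1 / u" if "u > 0" for u :: real using that by (simp add: field_simps)
      from this[OF s(3)[OF t]] s[OF t] show ?thesis by simp
    qed
    ultimately show "\<exists>y. ((\<lambda>t. ln (t + 1) - ln t - 1 / (t + 1/2)) has_real_derivative y) (at t) \<and> y < 0"
      by blast
  qed
  then have "(x + 1/2) * (1 / (x + 1/2)) \<le> (x + 1/2) * ln (1 + 1 / x)"
    unfolding ln using assms by (intro mult_left_mono) auto
  then show "0 \<le> (x + 1/2) * ln (1 + 1 / x) - 1" using assms by simp
  have "0 < (1 + inverse (x * (x + 1)) / 12) / (x + 1/2) - (ln (x + 1) - ln x)"
  proof (rule DERIV_neg_imp_decreasing_at_top[where
        f = "\<lambda>t. (1 + inverse (t * (t + 1)) / 12) / (t + 1/2) - (ln (t + 1) - ln t)"])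
    show "((\<lambda>t. (1 + inverse (t * (t + 1)) / 12) / (t + 1/2) - (ln (t + 1) - ln t)) \<longlongrightarrow> 0) (at_top :: real filter)"
      by real_asymp
    fix t assume "x \<le> t"
    then have t: "t > 0" using assms by simp
    define D where "D = - ((1 / 6) * ((t + 1/2) / (t * (t + 1))\<^sup>2)) / (t + 1/2)
         - (1 + inverse (t * (t + 1)) / 12) / (t + 1/2)\<^sup>2 - (1 / (t + 1) - 1 / t)"
    have "((\<lambda>t. 1 + inverse (t * (t + 1)) / 12) has_real_derivative
        - ((1 / 6) * ((t + 1/2) / (t * (t + 1))\<^sup>2))) (at t)"
    proof -
      have u: "((\<lambda>t. t * (t + 1)) has_real_derivative 2 * (t + 1/2)) (at t)"
        by (auto intro!: derivative_eq_intros simp: algebra_simps)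
      have "((\<lambda>t. 1 + inverse (t * (t + 1)) / 12) has_real_derivative
          0 + - (inverse (t * (t + 1)) * (2 * (t + 1/2)) * inverse (t * (t + 1))) / 12) (at t)"
        using s(3)[OF t] t by (intro DERIV_add DERIV_const DERIV_cdivide DERIV_inverse' u) simp
      moreover have e: "0 + - (inverse w * (2 * r) * inverse w) / 12 = - ((1 / 6) * (r / w\<^sup>2))" for w r :: real
        by (cases "w = 0") (simp_all add: field_simps power2_eq_square)
      ultimately show ?thesis by (simp only: e)
    qed
    then have "((\<lambda>t. (1 + inverse (t * (t + 1)) / 12) / (t + 1/2) - (ln (t + 1) - ln t)) has_real_derivative D) (at t)"
      unfolding D_def by (intro DERIV_diff quotD lnD t)
    moreover have "D < 0"
    proof -
      \<comment> \<open>Since \<open>(t + 1/2)^2 = u + 1/4\<close>, the derivative is a rational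
        function of \<open>u\<close> alone, and its numerator collapses to a negative
        constant.\<close>
      define u where "u = t * (t + 1)"
      have u: "u > 0" using s(3)[OF t] by (simp add: u_def)
      have "D = - 1 / (6 * u\<^sup>2) - (1 + inverse u / 12) / (u + 1/4) + 1 / u"
      proof -
        have "- ((1 / 6) * (r / u\<^sup>2)) / r = - 1 / (6 * u\<^sup>2)" if "r > 0" for r using that by simp
        then have "- ((1 / 6) * ((t + 1/2) / u\<^sup>2)) / (t + 1/2) = - 1 / (6 * u\<^sup>2)" using t by simp
        moreover have "1 / (t + 1) - 1 / t = - (1 / u)" using s(1)[OF t] by (simp add: u_def)
        ultimately show ?thesis unfolding D_def s(2)[OF t] u_def[symmetric] by simp
      qed
      also have "\<dots> = - (1 / (24 * u\<^sup>2 * (u + 1/4)))"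
      proof -
        define v where "v = u + 1/4"
        have v: "v > 0" "u = v - 1/4" using u by (simp_all add: v_def)
        have "- 1 / (6 * u\<^sup>2) - (1 + inverse u / 12) / v + 1 / u =
            (- 4 * v - (24 * u\<^sup>2 + 2 * u) + 24 * u * v) / (24 * u\<^sup>2 * v)"
          using u v(1) by (simp add: divide_simps power2_eq_square) (simp add: algebra_simps)
        also have "- 4 * v - (24 * u\<^sup>2 + 2 * u) + 24 * u * v = - 1"
          by (simp add: v_def algebra_simps power2_eq_square)
        finally show ?thesis by (simp add: v_def)
      qed
      also have "\<dots> < 0" using u by simp
      finally show ?thesis .
    qed
    ultimately show "\<exists>y. ((\<lambda>t. (1 + inverse (t * (t + 1)) / 12) / (t + 1/2) - (ln (t + 1) - ln t)) has_real_derivative y) (at t) \<and> y < 0"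
      by blast
  qed
  then have le: "(x + 1/2) * ln (1 + 1 / x) \<le> (x + 1/2) * ((1 + inverse (x * (x + 1)) / 12) / (x + 1/2))"
    unfolding ln using assms by (intro mult_left_mono) auto
  show "(x + 1/2) * ln (1 + 1 / x) - 1 \<le> (1 / x - 1 / (x + 1)) / 12"
  proof -
    have "(x + 1/2) * ((1 + inverse (x * (x + 1)) / 12) / (x + 1/2)) = 1 + (1 / x - 1 / (x + 1)) / 12"
      unfolding s(1)[OF assms] inverse_eq_divide using assms by simp
    with le show ?thesis by linarith
  qed
qed

text \<open>Binet's function plus the constant \<open>ln (sqrt (2 * pi))\<close> that is still to be
  identified.\<close>

definition stirling_rest :: "real \<Rightarrow> real" where
  "stirling_rest x = ln (Gamma x) - ((x - 1/2) * ln x - x)"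

lemma stirling_rest_diff:
  assumes "x > 0"
  shows "stirling_rest x - stirling_rest (x + 1) = (x + 1/2) * ln (1 + 1 / x) - 1"
proof -
  have "Gamma (x + 1) = x * Gamma x"
    using assms by (intro Gamma_plus1) (auto elim!: nonpos_Ints_cases)
  then have G: "ln (Gamma (x + 1)) = ln x + ln (Gamma x)"
    using Gamma_real_pos[OF assms] assms by (simp add: ln_mult_pos)
  have L: "ln (1 + 1 / x) = ln (x + 1) - ln x"
  proof -
    have "1 + 1 / x = (x + 1) / x" using assms by (simp add: field_simps)
    then show ?thesis using assms by (simp add: ln_div)
  qed
  show ?thesis
    unfolding stirling_rest_def G L by (simp add: algebra_simps)
qed

lemma stirling_rest_telescope:
  assumes "x > 0"
  shows "0 \<le> stirling_rest x - stirling_rest (x + real n)"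
    and "stirling_rest x - stirling_rest (x + real n) \<le> (1 / x - 1 / (x + real n)) / 12"
proof -
  have "0 \<le> stirling_rest x - stirling_rest (x + real n) \<and>
    stirling_rest x - stirling_rest (x + real n) \<le> (1 / x - 1 / (x + real n)) / 12"
  proof (induction n)
    case 0 show ?case by simp
  next
    case (Suc n)
    have p: "x + real n > 0" using assms by simp
    from stirling_rest_diff[OF p] ln_one_plus_inverse_bounds[OF p] Suc
    show ?case by (simp add: add_ac)
  qed
  then show "0 \<le> stirling_rest x - stirling_rest (x + real n)"
    and "stirling_rest x - stirling_rest (x + real n) \<le> (1 / x - 1 / (x + real n)) / 12"
    by blast+
qed

text \<open>Telescoping controls integer steps only, so the limit might depend on \<open>x\<close>
  modulo 1. The product formula behind \<open>Gamma_series'\<close> compares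
  \<open>Gamma (x + n)\<close> with \<open>fact (n - 1) * n powr x\<close> and excludes this; what
  remains is elementary.\<close>

lemma stirling_rest_shift:
  assumes "x > 0"
  shows "(\<lambda>n. stirling_rest (x + real n) - stirling_rest (1 + real n)) \<longlonglongrightarrow> 0"
proof -
  have xn: "x \<notin> \<int>\<^sub>\<le>\<^sub>0" using assms by (auto elim!: nonpos_Ints_cases)
  have pos: "Gamma x > 0" using assms by (rule Gamma_real_pos)
  have "Gamma_series' x \<longlonglongrightarrow> Gamma x" by (rule Gamma_series'_LIMSEQ)
  then have "(\<lambda>n. ln (Gamma_series' x n)) \<longlonglongrightarrow> ln (Gamma x)"
    using pos by (intro tendsto_ln) auto
  then have 1: "(\<lambda>n. ln (Gamma x) - ln (Gamma_series' x n)) \<longlonglongrightarrow> 0"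
    by (auto intro: tendsto_eq_intros)
  have 2: "(\<lambda>n. x * ln (real n) - ln (real n) - ((x + real n - 1/2) * ln (x + real n) - (x + real n))
       + ((1 + real n - 1/2) * ln (1 + real n) - (1 + real n))) \<longlonglongrightarrow> 0"
    using assms by real_asymp
  have eq: "\<forall>\<^sub>F n in sequentially. stirling_rest (x + real n) - stirling_rest (1 + real n) =
      (ln (Gamma x) - ln (Gamma_series' x n)) + (x * ln (real n) - ln (real n)
       - ((x + real n - 1/2) * ln (x + real n) - (x + real n))
       + ((1 + real n - 1/2) * ln (1 + real n) - (1 + real n)))"
    using eventually_gt_at_top[of 0]
  proof eventually_elim
    case (elim n)
    have g: "Gamma (x + real n) > 0" "Gamma (1 + real n) > 0"
      using assms by (auto intro!: Gamma_real_pos)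
    have "Gamma (1 + real n) = real n * fact (n - 1)"
      using elim by (simp add: Gamma_fact fact_reduce)
    then have "ln (Gamma (1 + real n)) = ln (real n) + ln (fact (n - 1))"
      using elim by (simp add: ln_mult)
    moreover have "ln (Gamma_series' x n) = ln (fact (n - 1)) + x * ln (real n) - (ln (Gamma (x + real n)) - ln (Gamma x))"
      using pos g elim
      by (simp add: Gamma_series'_def pochhammer_Gamma[OF xn] ln_mult ln_div)
    ultimately show ?case by (simp add: stirling_rest_def)
  qed
  show ?thesis
    using tendsto_add[OF 1 2] unfolding tendsto_cong[OF eq] by simp
qed

lemma Gamma_legendre_duplication_real:
  fixes x :: real
  assumes "x > 0"
  shows "Gamma x * Gamma (x + 1/2) = exp ((1 - 2 * x) * ln 2) * sqrt pi * Gamma (2 * x)"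
proof -
  have n: "complex_of_real y \<notin> \<int>\<^sub>\<le>\<^sub>0" if "y > 0" for y
    using that unfolding of_real_in_nonpos_Ints_iff by (auto elim!: nonpos_Ints_cases)
  have 1: "complex_of_real x + 1/2 = complex_of_real (x + 1/2)" by simp
  have 2: "2 * complex_of_real x = complex_of_real (2 * x)" by simp
  have 3: "(1 - complex_of_real (2 * x)) * of_real (ln 2) = complex_of_real ((1 - 2 * x) * ln 2)" by simp
  have "complex_of_real x + 1/2 \<notin> \<int>\<^sub>\<le>\<^sub>0" unfolding 1 using assms by (intro n) simp
  from Gamma_legendre_duplication[OF n[OF assms] this]
  have "complex_of_real (Gamma x * Gamma (x + 1/2)) =
      complex_of_real (exp ((1 - 2 * x) * ln 2) * sqrt pi * Gamma (2 * x))"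
    unfolding 1 2 3 Gamma_complex_of_real exp_of_real by (simp only: of_real_mult)
  then show ?thesis by (simp only: of_real_eq_iff)
qed

text \<open>Along the positive integers the sequence decreases and is bounded below, and the shift
  lemma carries its limit \<open>l\<close> to every \<open>x + n\<close>. Letting \<open>n\<close>
  tend to infinity in the telescoped bounds gives
  \<open>l <= stirling_rest x <= l + 1 / (12 * x)\<close>, hence a limit along the reals.\<close>

lemma stirling_rest_tendsto: "(stirling_rest \<longlongrightarrow> ln (sqrt (2 * pi))) at_top"
proof -
  have dec: "stirling_rest (1 + real n) \<ge> stirling_rest 1 - 1 / 12" for n
  proof -
    have "(1 / 1 - 1 / (1 + real n)) / 12 \<le> 1 / 12" by simp
    with stirling_rest_telescope(2)[of 1 n] show ?thesis by linarith
  qed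
  have "decseq (\<lambda>n. stirling_rest (1 + real n))"
    using stirling_rest_telescope(1)[of "1 + real n" 1 for n]
    by (intro decseq_SucI) (simp add: add_ac)
  then obtain l where l: "(\<lambda>n. stirling_rest (1 + real n)) \<longlonglongrightarrow> l"
    using decseq_convergent[of "\<lambda>n. stirling_rest (1 + real n)" "stirling_rest 1 - 1/12"] dec by metis
  have lx: "(\<lambda>n. stirling_rest (x + real n)) \<longlonglongrightarrow> l" if "x > 0" for x
    using tendsto_add[OF stirling_rest_shift[OF that] l] by simp
  have bnd: "l \<le> stirling_rest x" "stirling_rest x \<le> l + 1 / (12 * x)" if "x > 0" for x
  proof -
    show "l \<le> stirling_rest x"
      using lx[OF that] stirling_rest_telescope(1)[OF that]
      by (intro LIMSEQ_le_const2[of _ l]) auto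
    have "stirling_rest x - l \<le> 1 / (12 * x)"
    proof (rule LIMSEQ_le_const2)
      show "(\<lambda>n. stirling_rest x - stirling_rest (x + real n)) \<longlonglongrightarrow> stirling_rest x - l"
        by (intro tendsto_intros lx that)
      have "stirling_rest x - stirling_rest (x + real n) \<le> 1 / (12 * x)" for n
      proof -
        have "(1 / x - 1 / (x + real n)) / 12 \<le> 1 / (12 * x)" using that by simp
        with stirling_rest_telescope(2)[OF that, of n] show ?thesis by linarith
      qed
      then show "\<exists>M. \<forall>n\<ge>M. stirling_rest x - stirling_rest (x + real n) \<le> 1 / (12 * x)" by blast
    qed
    then show "stirling_rest x \<le> l + 1 / (12 * x)" by simp
  qed
  have lim: "(stirling_rest \<longlongrightarrow> l) at_top"
  proof (rule tendsto_sandwich)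
    show "\<forall>\<^sub>F x in at_top. l \<le> stirling_rest x"
      using eventually_gt_at_top[of 0] by eventually_elim (rule bnd)
    show "\<forall>\<^sub>F x in at_top. stirling_rest x \<le> l + 1 / (12 * x)"
      using eventually_gt_at_top[of 0] by eventually_elim (rule bnd)
    show "((\<lambda>x. l + 1 / (12 * x)) \<longlongrightarrow> l) at_top" by real_asymp
  qed simp
  \<comment> \<open>Legendre's duplication formula makes this combination elementary, while its
    limit contains \<open>l\<close> exactly once; this determines \<open>l\<close>.\<close>
  have A: "((\<lambda>x. stirling_rest x + stirling_rest (x + 1/2) - stirling_rest (2 * x)) \<longlongrightarrow> l + l - l) at_top"
  proof (intro tendsto_intros lim)
    show "((\<lambda>x. stirling_rest (x + 1/2)) \<longlongrightarrow> l) at_top"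
      by (rule filterlim_compose[OF lim]) real_asymp
    show "((\<lambda>x. stirling_rest (2 * x)) \<longlongrightarrow> l) at_top"
      by (rule filterlim_compose[OF lim]) real_asymp
  qed
  have eq: "\<forall>\<^sub>F x in at_top. stirling_rest x + stirling_rest (x + 1/2) - stirling_rest (2 * x)
     = (1 - 2 * x) * ln 2 + ln pi / 2 - ((x - 1/2) * ln x - x) - (x * ln (x + 1/2) - (x + 1/2))
       + ((2 * x - 1/2) * ln (2 * x) - 2 * x)"
    using eventually_gt_at_top[of 0]
  proof eventually_elim
    case (elim x)
    have "Gamma x * Gamma (x + 1/2) = exp ((1 - 2 * x) * ln 2) * sqrt pi * Gamma (2 * x)"
      by (rule Gamma_legendre_duplication_real[OF elim])
    then have "ln (Gamma x * Gamma (x + 1/2)) = ln (exp ((1 - 2 * x) * ln 2) * sqrt pi * Gamma (2 * x))"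
      by simp
    moreover have "Gamma x > 0" "Gamma (x + 1/2) > 0" "Gamma (2 * x) > 0"
      using elim by (auto intro!: Gamma_real_pos)
    ultimately have "ln (Gamma x) + ln (Gamma (x + 1/2)) = (1 - 2 * x) * ln 2 + ln pi / 2 + ln (Gamma (2 * x))"
      by (simp add: ln_mult ln_sqrt)
    then show ?case by (simp add: stirling_rest_def)
  qed
  have B: "((\<lambda>x. (1 - 2 * x) * ln 2 + ln pi / 2 - ((x - 1/2) * ln x - x) - (x * ln (x + 1/2) - (x + 1/2))
       + ((2 * x - 1/2) * ln (2 * x) - 2 * x)) \<longlongrightarrow> ln 2 / 2 + ln pi / 2) (at_top :: real filter)"
    by real_asymp
  have "l = ln 2 / 2 + ln pi / 2"
    using tendsto_unique[OF _ A[unfolded tendsto_cong[OF eq]] B] by simp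
  also have "\<dots> = ln (sqrt (2 * pi))" by (simp add: ln_sqrt ln_mult field_simps)
  finally show ?thesis using lim by simp
qed

section \<open>Stretching along a line\<close>

text \<open>Comparing boxes is enough. The preimage of a box is its image under the inverse map,
  hence measurable of finite measure, and \<open>f\<close> maps it back onto the box with factor
  \<open>\<bar>det (matrix f)\<bar>\<close>.\<close>

lemma lborel_linear_image:
  fixes f :: "real ^ 'n::{finite,wellorder} \<Rightarrow> real ^ 'n::_"
  assumes f: "linear f" and d: "det (matrix f) \<noteq> 0"
  shows "lborel = density (distr lborel borel f) (\<lambda>_. ennreal \<bar>det (matrix f)\<bar>)"
proof (rule lborel_eqI)
  fix l u :: "real ^ 'n::_"
  assume lu: "\<And>b. b \<in> Basis \<Longrightarrow> l \<bullet> b \<le> u \<bullet> b"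
  have inj: "inj f" using f d by (simp add: det_nz_iff_inj)
  then have bij: "bij f" using f by (simp add: bij_def linear_injective_imp_surjective)
  have meas: "f \<in> borel_measurable borel"
    using f by (intro borel_measurable_continuous_onI linear_continuous_on) (simp add: linear_conv_bounded_linear)
  have lin: "linear (inv f)" using f inj by (rule inj_linear_imp_inv_linear)
  define B where "B = f -` box l u"
  have "B = inv f ` box l u" unfolding B_def using bij by (simp add: bij_vimage_eq_inv_image)
  then have B: "B \<in> lmeasurable" by (simp add: measurable_linear_image[OF lin])
  have Bs: "B \<in> sets lborel" unfolding B_def using measurable_sets[OF meas, of "box l u"] by simp
  have "f ` B = box l u" unfolding B_def using bij by (simp add: bij_is_surj)
  then have m: "measure lebesgue (box l u) = \<bar>det (matrix f)\<bar> * measure lebesgue B"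
    using measure_linear_image[OF f B] by simp
  have "emeasure (density (distr lborel borel f) (\<lambda>_. ennreal \<bar>det (matrix f)\<bar>)) (box l u)
     = ennreal \<bar>det (matrix f)\<bar> * emeasure lborel B"
    using meas by (simp add: emeasure_density_const emeasure_distr B_def)
  also have "emeasure lborel B = ennreal (measure lebesgue B)"
    using emeasure_eq_measure2[OF B] Bs by simp
  also have "ennreal \<bar>det (matrix f)\<bar> * \<dots> = ennreal (measure lebesgue (box l u))"
    by (simp add: m ennreal_mult)
  also have "measure lebesgue (box l u) = (\<Prod>b\<in>Basis. (u - l) \<bullet> b)"
    using lu by (simp add: measure_lborel_box_eq)
  finally show "emeasure (density (distr lborel borel f) (\<lambda>_. ennreal \<bar>det (matrix f)\<bar>)) (box l u)
     = ennreal (\<Prod>b\<in>Basis. (u - l) \<bullet> b)" .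
qed simp

text \<open>Common form of \<open>rescaling z k\<close>, with \<open>c = 1 / sqrt k\<close>, and of
  its inverse, with \<open>c = sqrt k\<close>.\<close>

definition stretch :: "real \<Rightarrow> 'a::real_inner \<Rightarrow> 'a \<Rightarrow> 'a" where
  "stretch c z x = c *\<^sub>R proj_line z x + proj_perp z x"

lemma stretch_eq: "stretch c z x = x + ((c - 1) * (x \<bullet> z) / (norm z)\<^sup>2) *\<^sub>R z"
  by (simp add: stretch_def proj_perp_def proj_line_def algebra_simps diff_divide_distrib)

lemma linear_stretch: "linear (stretch c z)"
  by (rule linearI) (simp_all add: stretch_eq inner_add_left algebra_simps add_divide_distrib diff_divide_distrib)

text \<open>The map is expressed through inner products with \<open>z\<close>, so linear isometries
  intertwine it. This serves both for a rotation and for the passage to another index type.\<close>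

lemma stretch_commute:
  assumes f: "linear f" and "\<And>x y. f x \<bullet> f y = x \<bullet> y"
  shows "f (stretch c z x) = stretch c (f z) (f x)"
  using assms(2)
  by (simp add: stretch_eq linear_add[OF f] linear_cmul[OF f] norm_eq_sqrt_inner)

text \<open>An orthogonal map takes \<open>z\<close> to a multiple of a basis vector. Conjugation by
  it keeps the determinant and makes the matrix diagonal with entries 1 and a single
  \<open>c\<close>.\<close>

lemma det_stretch:
  fixes z :: "real ^ 'n"
  assumes z: "z \<noteq> 0"
  shows "det (matrix (stretch c z)) = c"
proof -
  obtain k :: 'n where True by blast
  let ?e = "axis k 1 :: real ^ 'n"
  obtain F where F: "orthogonal_transformation F" "F z = norm z *\<^sub>R ?e"
    using orthogonal_transformation_exists[of z "norm z *\<^sub>R ?e"] by (auto simp: norm_axis_1)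
  have m: "matrix (stretch c ?e) $ i $ j = (if i = j then if i = k then c else 1 else 0)" for i j
    by (simp add: matrix_def stretch_eq norm_axis_1 inner_axis_axis) (auto simp: axis_def)
  have linF: "linear F" using F(1) by (simp add: orthogonal_transformation_linear)
  have "F \<circ> stretch c z = stretch c (F z) \<circ> F"
    using F(1) by (auto simp: stretch_commute orthogonal_transformation_def)
  also have "stretch c (F z) = stretch c ?e"
    using z by (auto simp: F(2) stretch_eq power_mult_distrib norm_axis_1 power2_eq_square)
  finally have "F \<circ> stretch c z = stretch c ?e \<circ> F" .
  then have "det (matrix F ** matrix (stretch c z)) = det (matrix (stretch c ?e) ** matrix F)"
    by (simp add: matrix_compose[OF linear_stretch linF, symmetric] matrix_compose[OF linF linear_stretch, symmetric])
  moreover have "det (matrix F) \<noteq> 0"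
    using F(1) orthogonal_transformation_det by fastforce
  ultimately have "det (matrix (stretch c z)) = det (matrix (stretch c ?e))"
    by (simp add: det_mul)
  also have "\<dots> = (\<Prod>i\<in>UNIV. matrix (stretch c ?e) $ i $ i)"
    by (rule det_diagonal) (simp add: m)
  also have "\<dots> = (\<Prod>i\<in>UNIV. if i = k then c else 1)" by (simp add: m)
  also have "\<dots> = c" by simp
  finally show ?thesis .
qed

text \<open>
  The library states the transformation formula for linear maps of \<open>real ^ 'n\<close> only for
  well-ordered index types, so a finite linear order is copied into such a type.
\<close>

typedef 'a well_copy = "UNIV :: 'a set" ..

setup_lifting type_definition_well_copy

instantiation well_copy :: ("{finite,linorder}") "{finite,wellorder}"
begin

lift_definition less_eq_well_copy :: "'a well_copy \<Rightarrow> 'a well_copy \<Rightarrow> bool" is "(\<le>)" .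
lift_definition less_well_copy :: "'a well_copy \<Rightarrow> 'a well_copy \<Rightarrow> bool" is "(<)" .

instance
proof
  fix x y z :: "'a well_copy"
  show "(x < y) = (x \<le> y \<and> \<not> y \<le> x)" by transfer auto
  show "x \<le> x" by transfer auto
  show "x \<le> y \<Longrightarrow> y \<le> z \<Longrightarrow> x \<le> z" by transfer auto
  show "x \<le> y \<Longrightarrow> y \<le> x \<Longrightarrow> x = y" by transfer auto
  show "x \<le> y \<or> y \<le> x" by transfer auto
next
  show "finite (UNIV :: 'a well_copy set)"
    unfolding type_definition.Abs_image[OF type_definition_well_copy, symmetric] by simp
next
  fix P :: "'a well_copy \<Rightarrow> bool" and a
  assume IH: "\<And>x. (\<And>y. y < x \<Longrightarrow> P y) \<Longrightarrow> P x"
  have "P (Abs_well_copy r)" for r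
  proof (induction r rule: measure_induct_rule[of "\<lambda>r. card {..<r}"])
    case (less r)
    show ?case
    proof (rule IH)
      fix y assume "y < Abs_well_copy r"
      then have "Rep_well_copy y < r" by (simp add: less_well_copy.rep_eq Abs_well_copy_inverse)
      then have "card {..<Rep_well_copy y} < card {..<r}" by (intro psubset_card_mono) auto
      then show "P y" using less[of "Rep_well_copy y"] by (simp add: Rep_well_copy_inverse)
    qed
  qed
  from this[of "Rep_well_copy a"] show "P a" by (simp add: Rep_well_copy_inverse)
qed

end

lemma bij_Rep_well_copy: "bij Rep_well_copy"
  by (rule bij_betw_byWitness[of _ Abs_well_copy]) (auto simp: Abs_well_copy_inverse Rep_well_copy_inverse)

lemma all_well_copy: "(\<forall>i. Q i (Rep_well_copy i)) = (\<forall>j. Q (Abs_well_copy j) j)"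
proof (intro iffI allI)
  show "Q (Abs_well_copy j) j" if "\<forall>i. Q i (Rep_well_copy i)" for j
    using that[rule_format, of "Abs_well_copy j"] by (simp add: Abs_well_copy_inverse)
  show "Q i (Rep_well_copy i)" if "\<forall>j. Q (Abs_well_copy j) j" for i
    using that[rule_format, of "Rep_well_copy i"] by (simp add: Rep_well_copy_inverse)
qed

definition copy_vec :: "real ^ 'n::{finite,linorder} \<Rightarrow> real ^ ('n well_copy)" where
  "copy_vec x = (\<chi> i. x $ Rep_well_copy i)"

lemma linear_copy_vec: "linear copy_vec"
  by (rule linearI) (simp_all add: copy_vec_def vec_eq_iff)

lemma inner_copy_vec: "copy_vec x \<bullet> copy_vec y = x \<bullet> (y :: real ^ 'n::{finite,linorder})"
  by (simp add: copy_vec_def inner_vec_def sum.reindex_bij_betw[OF bij_Rep_well_copy, of "\<lambda>i. x $ i * y $ i"])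

lemma prod_Basis_cart: "(\<Prod>b\<in>Basis. (x :: real ^ 'n) \<bullet> b) = (\<Prod>i\<in>UNIV. x $ i)"
proof -
  have B: "(Basis :: (real ^ 'n) set) = (\<lambda>i. axis i 1) ` UNIV" by (auto simp: Basis_vec_def)
  have "inj (\<lambda>i. axis i 1 :: real ^ 'n)" by (auto simp: inj_def axis_eq_axis)
  then show ?thesis unfolding B by (subst prod.reindex) (auto simp: inner_axis)
qed

lemma measurable_copy_vec: "copy_vec \<in> borel_measurable (borel :: (real ^ 'n::{finite,linorder}) measure)"
  using linear_copy_vec
  by (intro borel_measurable_continuous_onI linear_continuous_on) (simp add: linear_conv_bounded_linear)

text \<open>A box pulls back to a box with the same side lengths under renamed indices, so the
  volumes agree.\<close>

lemma lborel_copy_vec: "lborel = distr (lborel :: (real ^ 'n::{finite,linorder}) measure) borel copy_vec"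
proof (rule lborel_eqI)
  fix l u :: "real ^ ('n well_copy)"
  assume lu: "\<And>b. b \<in> Basis \<Longrightarrow> l \<bullet> b \<le> u \<bullet> b"
  define c :: "real ^ ('n well_copy) \<Rightarrow> real ^ 'n::_" where "c x = (\<chi> i. x $ Abs_well_copy i)" for x
  have le: "l $ i \<le> u $ i" for i
    using lu[of "axis i 1"] by (auto simp: inner_axis Basis_vec_def)
  have "copy_vec -` box l u = box (c l) (c u)"
    using all_well_copy[of "\<lambda>i j. l $ i < x $ j \<and> x $ j < u $ i" for x]
    by (auto simp: mem_box_cart copy_vec_def c_def)
  then have "emeasure (distr lborel borel copy_vec) (box l u) = emeasure lborel (box (c l) (c u))"
    by (simp add: emeasure_distr measurable_copy_vec)
  also have "\<dots> = ennreal (\<Prod>b\<in>Basis. (c u - c l) \<bullet> b)"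
    by (rule emeasure_lborel_box) (auto simp: Basis_vec_def inner_axis c_def le)
  also have "(\<Prod>b\<in>Basis. (c u - c l) \<bullet> b) = (\<Prod>b\<in>Basis. (u - l) \<bullet> b)"
    unfolding prod_Basis_cart
    by (subst prod.reindex_bij_betw[OF bij_Rep_well_copy, symmetric])
       (simp add: c_def Rep_well_copy_inverse)
  finally show "emeasure (distr lborel borel copy_vec) (box l u) = ennreal (\<Prod>b\<in>Basis. (u - l) \<bullet> b)" .
qed simp

lemma measurable_stretch [measurable]: "stretch c (z :: real ^ 'n) \<in> borel_measurable borel"
  using linear_stretch[of c z]
  by (intro borel_measurable_continuous_onI linear_continuous_on) (simp add: linear_conv_bounded_linear)

lemma nn_integral_stretch:
  fixes z :: "real ^ 'n::{finite,linorder}"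
  assumes z: "z \<noteq> 0" and c: "c > 0" and [measurable]: "g \<in> borel_measurable borel"
  shows "(\<integral>\<^sup>+x. g x \<partial>lborel) = (\<integral>\<^sup>+x. ennreal c * g (stretch c z x) \<partial>lborel)"
proof -
  let ?Z = "copy_vec z"
  \<comment> \<open>\<open>r\<close> inverts \<open>copy_vec\<close>, so that \<open>g\<close> can
    be read as the function \<open>g (r x)\<close> on the copied space, where the determinant
    formula applies.\<close>
  define r :: "real ^ ('n well_copy) \<Rightarrow> real ^ 'n::_" where "r x = (\<chi> i. x $ Abs_well_copy i)" for x
  have r: "r (copy_vec x) = x" for x
    by (simp add: r_def copy_vec_def vec_eq_iff Abs_well_copy_inverse)
  have "linear r" by (rule linearI) (simp_all add: r_def vec_eq_iff)
  then have [measurable]: "r \<in> borel_measurable borel"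
    by (intro borel_measurable_continuous_onI linear_continuous_on) (simp add: linear_conv_bounded_linear)
  note [measurable] = measurable_copy_vec
  have Z: "?Z \<noteq> 0" using z r[of z] r[of 0] by (metis linear_0 linear_copy_vec)
  have *: "(\<integral>\<^sup>+x. h (copy_vec x) \<partial>lborel) = (\<integral>\<^sup>+x. h x \<partial>lborel)"
    if [measurable]: "h \<in> borel_measurable borel" for h :: "real ^ ('n well_copy) \<Rightarrow> ennreal"
  proof -
    have "(\<integral>\<^sup>+x. h x \<partial>lborel) = (\<integral>\<^sup>+x. h x \<partial>distr (lborel :: (real ^ 'n::_) measure) borel copy_vec)"
      using lborel_copy_vec by (rule arg_cong[where f = "\<lambda>M. nn_integral M h"])
    then show ?thesis by (simp add: nn_integral_distr)
  qed
  have "(\<integral>\<^sup>+x. g x \<partial>lborel) = (\<integral>\<^sup>+x. g (r (copy_vec x)) \<partial>lborel)" by (simp add: r)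
  also have "\<dots> = (\<integral>\<^sup>+x. g (r x) \<partial>lborel)" by (rule *) measurable
  also have "\<dots> = (\<integral>\<^sup>+x. g (r x) \<partial>density (distr lborel borel (stretch c ?Z)) (\<lambda>_. ennreal c))"
    using lborel_linear_image[OF linear_stretch, of c ?Z] c by (simp add: det_stretch[OF Z])
  also have "\<dots> = (\<integral>\<^sup>+x. ennreal c * g (r (stretch c ?Z x)) \<partial>lborel)"
    by (simp add: nn_integral_density nn_integral_distr)
  also have "\<dots> = (\<integral>\<^sup>+x. ennreal c * g (r (stretch c ?Z (copy_vec x))) \<partial>lborel)"
    by (rule *[symmetric]) measurable
  also have "\<dots> = (\<integral>\<^sup>+x. ennreal c * g (stretch c z x) \<partial>lborel)"
    by (simp add: stretch_commute[OF linear_copy_vec inner_copy_vec, symmetric] r)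
  finally show ?thesis .
qed

section \<open>Dominated convergence of the rescaled densities\<close>

text \<open>Cover the space by the balls of radius \<open>2 ^ j\<close>. Outside the previous ball
  the function is at most \<open>2 ^ (- (j - 1) * (d + 1))\<close> with \<open>d\<close> the
  dimension, and the volume grows like \<open>2 ^ (j * d)\<close>, which leaves a geometric series
  of ratio 1/2.\<close>

lemma integrable_Cauchy_tail:
  "integrable lborel (\<lambda>x::'a::euclidean_space. (1 + (norm x)\<^sup>2) powr (- (real DIM('a) + 1) / 2))"
proof (rule integrableI_bounded)
  let ?d = "DIM('a)"
  let ?f = "\<lambda>x::'a. (1 + (norm x)\<^sup>2) powr (- (real ?d + 1) / 2)"
  show "?f \<in> borel_measurable lborel" by measurable
  define V where "V = unit_ball_vol (real ?d)"
  have V: "V \<ge> 0" by (simp add: V_def)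
  \<comment> \<open>\<open>a j\<close> bounds the function on the shell between the radii
    \<open>2 ^ (j - 1)\<close> and \<open>2 ^ j\<close>; \<open>j = 0\<close> stands for the whole
    unit ball.\<close>
  define a where "a j = (if j = 0 then 1 else (1 / 2 ^ (j - 1)) ^ (?d + 1) :: real)" for j :: nat
  have bound: "ennreal (?f x) \<le> (\<Sum>j. ennreal (a j) * indicator (cball 0 (2 ^ j)) x)" for x
  proof -
    obtain n where "norm x < 2 ^ n" using real_arch_pow[of 2 "norm x"] by auto
    \<comment> \<open>Minimality of \<open>j\<close> provides the lower bound
      \<open>2 ^ (j - 1)\<close> for the norm when \<open>j > 0\<close>.\<close>
    then obtain j where j: "norm x \<le> 2 ^ j" "\<And>i. i < j \<Longrightarrow> \<not> norm x \<le> 2 ^ i"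
      using LeastI_ex[of "\<lambda>j. norm x \<le> 2 ^ j"] not_less_Least by (metis (no_types, lifting) less_imp_le)
    have "?f x \<le> a j"
    proof (cases j)
      case 0
      have "?f x \<le> (1 + (norm x)\<^sup>2) powr 0" by (intro powr_mono) auto
      then show ?thesis by (simp add: a_def 0 add_nonneg_eq_0_iff)
    next
      case (Suc i)
      with j have i: "2 ^ i \<le> norm x" by (metis less_imp_le lessI linear)
      have "?f x = 1 / (1 + (norm x)\<^sup>2) powr ((real ?d + 1) / 2)"
        unfolding minus_divide_left[symmetric] by (rule powr_minus_divide)
      also have "\<dots> \<le> 1 / ((2 ^ i)\<^sup>2) powr ((real ?d + 1) / 2)"
      proof (intro divide_left_mono powr_mono2)
        have "(2 ^ i)\<^sup>2 \<le> (norm x)\<^sup>2" using i by (intro power_mono) auto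
        then show "(2 ^ i)\<^sup>2 \<le> 1 + (norm x)\<^sup>2" by linarith
      qed (auto intro!: mult_pos_pos simp: add_nonneg_eq_0_iff)
      also have "((2 ^ i)\<^sup>2) powr ((real ?d + 1) / 2) = (2 ^ i :: real) ^ (?d + 1)"
      proof -
        have "((2 ^ i)\<^sup>2) powr ((real ?d + 1) / 2) = ((2 ^ i :: real) powr 2) powr ((real ?d + 1) / 2)"
          by simp
        also have "\<dots> = (2 ^ i :: real) powr real (?d + 1)"
          unfolding powr_powr by (rule arg_cong[where f = "\<lambda>y. (2 ^ i) powr y"]) simp
        finally show ?thesis by (subst (asm) powr_realpow) auto
      qed
      finally show ?thesis by (simp add: a_def Suc power_one_over)
    qed
    then have "ennreal (?f x) \<le> ennreal (a j) * indicator (cball 0 (2 ^ j)) x"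
      using j(1) by (simp add: ennreal_leI)
    also have "\<dots> \<le> (\<Sum>j. ennreal (a j) * indicator (cball 0 (2 ^ j)) x)"
    proof -
      have "f j \<le> suminf f" for f :: "nat \<Rightarrow> ennreal" using sum_le_suminf[of f "{j}"] by simp
      then show ?thesis .
    qed
    finally show ?thesis .
  qed
  have meas: "(\<lambda>x::'a. ennreal (a j) * indicator (cball 0 (2 ^ j)) x) \<in> borel_measurable borel" for j
    by (intro borel_measurable_times_ennreal borel_measurable_const borel_measurable_indicator) simp
  have "(\<integral>\<^sup>+ x. ennreal (norm (?f x)) \<partial>lborel) = (\<integral>\<^sup>+ x. ennreal (?f x) \<partial>lborel)" by simp
  also have "\<dots> \<le> (\<integral>\<^sup>+ x. (\<Sum>j. ennreal (a j) * indicator (cball 0 (2 ^ j)) x) \<partial>(lborel :: 'a measure))"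
    by (intro nn_integral_mono bound)
  also have "\<dots> = (\<Sum>j. ennreal (a j) * emeasure (lborel :: 'a measure) (cball 0 (2 ^ j)))"
    by (subst nn_integral_suminf) (simp_all add: nn_integral_cmult_indicator meas)
  also have "\<dots> = (\<Sum>j. ennreal (a j * (V * (2 ^ j) ^ ?d)))"
    by (intro suminf_cong) (simp add: emeasure_cball V_def ennreal_mult' a_def)
  also have "\<dots> < \<infinity>"
  proof -
    have "summable (\<lambda>j. V * 2 ^ (?d + 1) * (1 / 2) ^ j)"
      by (intro summable_mult summable_geometric) auto
    moreover have "norm (a j * (V * (2 ^ j) ^ ?d)) \<le> V * 2 ^ (?d + 1) * (1 / 2) ^ j" for j
    proof (cases j)
      case 0
      have "(1::real) \<le> 2 ^ (?d + 1)" by (rule one_le_power) simp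
      then show ?thesis using V mult_left_mono[of 1 "2 ^ (?d + 1) :: real" V] by (simp add: a_def 0)
    next
      case (Suc i)
      have "(2 ^ i :: real) \<noteq> 0" by simp
      then show ?thesis using V
        by (simp add: a_def Suc power_mult_distrib power_one_over field_simps)
    qed
    ultimately have "summable (\<lambda>j. a j * (V * (2 ^ j) ^ ?d))"
      by (rule summable_comparison_test'[where N = 0])
    then have "(\<Sum>j. ennreal (a j * (V * (2 ^ j) ^ ?d))) = ennreal (\<Sum>j. a j * (V * (2 ^ j) ^ ?d))"
      using V by (intro suminf_ennreal2) (auto simp: a_def)
    then show ?thesis by simp
  qed
  finally show "(\<integral>\<^sup>+ x. ennreal (norm (?f x)) \<partial>lborel) < \<infinity>" .
qed

lemma ln_Gamma_one_plus:
  assumes "x > 0"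
  shows "ln (Gamma (1 + x)) = stirling_rest x + (x + 1/2) * ln x - x"
proof -
  have "Gamma (x + 1) = x * Gamma x"
    using assms by (intro Gamma_plus1) (auto elim!: nonpos_Ints_cases)
  then have "ln (Gamma (1 + x)) = ln x + ln (Gamma x)"
    using Gamma_real_pos[OF assms] assms by (simp add: ln_mult_pos add.commute)
  then show ?thesis by (simp add: stirling_rest_def algebra_simps)
qed

text \<open>The case \<open>1 + v = 0\<close> is included because a factor of the root product
  vanishes on a wall of the chamber.\<close>

lemma powr_le_exp_mult:
  fixes v :: real
  assumes "1 + v \<ge> 0" "c \<ge> 0"
  shows "(1 + v) powr c \<le> exp (c * v)"
proof -
  have "(1 + v) powr c \<le> exp v powr c"
    using assms by (intro powr_mono2) auto
  then show ?thesis by (simp add: exp_powr_real mult.commute)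
qed

text \<open>
  With \<open>r = k p / (s + k p)\<close>, \<open>t = 1 - r\<close> and \<open>M = k d / e\<close>, the quotient of the two sides without the
  constant is the \<open>e\<close>-th power of \<open>r powr M * (k t + r)\<close>, and \<open>M t exp (- M t) \<le> 1\<close>.
\<close>

lemma radial_bound:
  fixes k p s d e :: real
  assumes k: "k > 0" and p: "p > 0" and s: "s > 0" and d: "d > 0" and e: "e > 0"
  shows "k powr e * (k * p) powr (k * d) * (s + k * p) powr - (k * d + e)
     \<le> (1 + e / d) powr e * (s + p) powr - e"
proof -
  define q where "q = s + k * p"
  define r where "r = k * p / q"
  define t where "t = s / q"
  define M where "M = k * d / e"
  have q: "q > 0" using assms by (simp add: q_def add_pos_pos)
  have rt: "r = 1 - t" using q by (simp add: r_def t_def q_def field_simps)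
  have r: "r > 0" "r \<le> 1" and t: "t > 0" using q k p s by (simp_all add: r_def t_def) (simp add: q_def)
  have M: "M > 0" using assms by (simp add: M_def)
  have "r powr M \<le> exp (M * - t)"
    using powr_le_exp_mult[of "- t" M] r M by (simp add: rt)
  then have rM: "r powr M \<le> exp (- (M * t))" by simp
  have "M * t * r powr M \<le> M * t * exp (- (M * t))"
    using rM M t by (intro mult_left_mono) auto
  also have "\<dots> \<le> 1"
  proof -
    have "M * t \<le> exp (M * t)" using exp_ge_add_one_self[of "M * t"] by linarith
    then show ?thesis by (simp add: exp_minus field_simps)
  qed
  finally have "k * t * r powr M \<le> e / d"
    using k e d by (simp add: M_def field_simps)
  moreover have "r * r powr M \<le> 1 * 1"
    using r M by (intro mult_mono powr_le1) auto
  ultimately have b: "r powr M * (k * (s + p) / q) \<le> 1 + e / d"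
    by (simp add: r_def t_def algebra_simps add_divide_distrib)
  have "k powr e * (k * p) powr (k * d) * (s + k * p) powr - (k * d + e)
     = (k * p) powr (k * d) / q powr (k * d) * (k powr e / q powr e)"
    using q by (simp add: q_def[symmetric] powr_minus_divide powr_add powr_diff)
  also have "\<dots> = r powr (k * d) * (k / q) powr e"
    using q k p by (simp add: r_def powr_divide)
  also have "\<dots> = (r powr M * (k / q)) powr e"
  proof -
    have "(r powr M * (k / q)) powr e = (r powr M) powr e * (k / q) powr e"
      by (rule powr_mult)
    then show ?thesis using e by (simp add: powr_powr M_def)
  qed
  also have "\<dots> = (r powr M * (k * (s + p) / q)) powr e * (s + p) powr - e"
  proof -
    have "(r powr M * (k * (s + p) / q)) powr e = ((r powr M * (k / q)) * (s + p)) powr e"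
      by (simp add: mult_ac)
    also have "\<dots> = (r powr M * (k / q)) powr e * (s + p) powr e"
      by (rule powr_mult)
    finally show ?thesis using s p by (simp add: powr_minus field_simps)
  qed
  also have "\<dots> \<le> (1 + e / d) powr e * (s + p) powr - e"
    using b e q k s p r by (intro mult_right_mono powr_mono2) auto
  finally show ?thesis .
qed

text \<open>Writing \<open>s + k * p = k * p * (1 + (s / p) / k)\<close> cancels all powers of
  \<open>k\<close>; what is left is the compound-interest limit for
  \<open>exp (- d * s / p)\<close>.\<close>

lemma radial_limit:
  fixes p s d e :: real
  assumes p: "p > 0" and s: "s > 0" and d: "d > 0"
  shows "((\<lambda>k. k powr e * (k * p) powr (k * d) * (s + k * p) powr - (k * d + e))
     \<longlongrightarrow> p powr - e * exp (- d * s / p)) at_top"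
proof -
  have A: "((\<lambda>k. p powr - e * (1 + (s / p) / k) powr - e * exp (- d * (k * ln (1 + (s / p) / k)))) \<longlongrightarrow>
       p powr - e * 1 powr - e * exp (- d * (s / p))) at_top"
  proof (intro tendsto_intros)
    show "((\<lambda>k. 1 + (s / p) / k) \<longlongrightarrow> 1) at_top" by real_asymp
    show "((\<lambda>k. k * ln (1 + (s / p) / k)) \<longlongrightarrow> s / p) at_top"
    proof -
      define c where "c = s / p"
      have "c > 0" using p s by (simp add: c_def)
      then show ?thesis unfolding c_def[symmetric] by real_asymp
    qed
  qed auto
  have B: "\<forall>\<^sub>F k in at_top. p powr - e * (1 + (s / p) / k) powr - e * exp (- d * (k * ln (1 + (s / p) / k)))
     = k powr e * (k * p) powr (k * d) * (s + k * p) powr - (k * d + e)"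
    using eventually_gt_at_top[of 0]
  proof eventually_elim
    case (elim k)
    define w where "w = 1 + (s / p) / k"
    have w: "w > 0" using elim p s by (simp add: w_def add_pos_pos)
    have "s + k * p = k * p * w" using elim p by (simp add: w_def field_simps)
    then have "k powr e * (k * p) powr (k * d) * (s + k * p) powr - (k * d + e)
      = k powr e * (k * p) powr (k * d) * ((k * p) powr - (k * d + e) * w powr - (k * d + e))"
      using elim p w by (simp add: powr_mult)
    also have "\<dots> = k powr e * ((k * p) powr (k * d + - (k * d + e))) * w powr - (k * d + e)"
      by (simp only: powr_add mult.assoc)
    also have "\<dots> = p powr - e * w powr - (k * d + e)"
      using elim p by (simp add: powr_mult powr_minus field_simps)
    also have "w powr - (k * d + e) = w powr - e * exp (- d * (k * ln w))"
      using w by (simp add: powr_def mult_exp_exp algebra_simps)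
    finally show ?case by (simp add: w_def)
  qed
  show ?thesis using A unfolding tendsto_cong[OF B] by simp
qed

text \<open>Second-order expansion of the logarithm. The subtracted \<open>u / sqrt k\<close> is the
  linear term, which disappears on multiplying over all pairs. The cases on the sign of
  \<open>u\<close> serve the asymptotic expansion.\<close>

lemma root_factor_limit:
  "((\<lambda>k. exp (2 * k * (ln (1 + u / sqrt k) - u / sqrt k))) \<longlongrightarrow> exp (- (u\<^sup>2))) (at_top :: real filter)"
proof -
  consider "u = 0" | "u > 0" | "u < 0" by linarith
  then show ?thesis
  proof cases
    case 2
    then have "((\<lambda>k. exp (2 * k * (ln (1 + u / sqrt k) - u / sqrt k))) \<longlongrightarrow> exp (- (u * u))) at_top"
      by real_asymp
    then show ?thesis by (simp add: power2_eq_square)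
  next
    case 3
    define v where "v = - u"
    have "v > 0" using 3 by (simp add: v_def)
    then have "((\<lambda>k. exp (2 * k * (ln (1 - v / sqrt k) + v / sqrt k))) \<longlongrightarrow> exp (- (v * v))) at_top"
      by real_asymp
    then show ?thesis by (simp add: power2_eq_square v_def)
  qed simp
qed

section \<open>Limit of the factor that does not depend on the point\<close>

locale freezing = hermite_zeros z for z :: "real ^ 'n::{finite,linorder}" +
  assumes card_ge_2: "CARD('n) \<ge> 2"
begin

text \<open>Both the number of pairs and the squared norm of \<open>z\<close>; this coincidence is
  what makes the exponents fit together. The exponent in the density is
  \<open>k * d + e\<close>.\<close>

definition d :: real where "d = real CARD('n) * (real CARD('n) - 1) / 2"
definition e :: real where "e = (real CARD('n) + 1) / 2"

lemma de_pos: "d > 0" "e > 0"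
  using card_ge_2 by (simp_all add: d_def e_def)

lemma norm_zeros_d: "(norm z)\<^sup>2 = d" "z \<bullet> z = d" "real (card pairs) = d"
  using norm_zeros card_pairs by (simp_all add: d_def power2_norm_eq_inner)

lemma z_nonzero: "z \<noteq> 0"
  using norm_zeros_d(1) de_pos by auto

text \<open>\<open>k powr - (N / 2)\<close> remains of the Jacobian \<open>sqrt k\<close> once
  \<open>k powr e\<close> has gone to the radial factor. \<open>d powr - (k * d)\<close> comes from
  expressing the coefficient of \<open>z\<close> through the length of the projection.\<close>

definition front_factor :: "real \<Rightarrow> real" where
  "front_factor k = norming_const k CARD('n) * k powr - (real CARD('n) / 2) * d powr - (k * d)
     * (\<Prod>(i, j)\<in>pairs. (z $ i - z $ j) powr (2 * k))"

text \<open>The constant of \<open>limit_density\<close> without \<open>exp (N * (N - 1))\<close>,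
  which cancels against terms hidden in the exponent.\<close>

definition limit_const :: real where
  "limit_const = sqrt (fact CARD('n)) * sqrt 2 * d powr (real CARD('n) / 2) / pi powr (real CARD('n) / 2)"

lemma norming_const_pos: "k > 0 \<Longrightarrow> norming_const k CARD('n) > 0"
  unfolding norming_const_def using de_pos(1)[unfolded d_def] card_ge_2
  by (intro mult_pos_pos divide_pos_pos prod_pos Gamma_real_pos add_pos_pos ballI) 
     (auto intro!: Gamma_real_pos add_pos_pos mult_nonneg_nonneg add_nonneg_pos)

text \<open>In this form the sum of \<open>j * ln j\<close> can cancel the term of order
  \<open>k\<close> that Stirling's formula produces for the product of the
  \<open>Gamma (1 + j * k)\<close>.\<close>

lemma ln_discriminant:
  "(\<Sum>(i, j)\<in>pairs. 2 * ln (z $ i - z $ j)) = (\<Sum>j=1..CARD('n). real j * ln (real j)) - d * ln 2"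
proof -
  have "(\<Prod>(i, j)\<in>pairs. (z $ i - z $ j)\<^sup>2) > 0"
    by (intro prod_pos) (auto dest: zeros_strict)
  then have "ln (2 ^ (CARD('n) * CARD('n)) * (\<Prod>(i, j)\<in>pairs. (z $ i - z $ j)\<^sup>2))
      = real (CARD('n) * CARD('n)) * ln 2 + ln (\<Prod>(i, j)\<in>pairs. (z $ i - z $ j)\<^sup>2)"
    by (subst ln_mult_pos) (simp_all add: ln_realpow)
  moreover have "ln (\<Prod>(i, j)\<in>pairs. (z $ i - z $ j)\<^sup>2) = (\<Sum>(i, j)\<in>pairs. 2 * ln (z $ i - z $ j))"
    by (subst ln_prod) (auto dest: zeros_strict simp: ln_realpow intro!: sum.cong)
  moreover have "ln (\<Prod>j=1..CARD('n). (2 * real j) ^ j) = (\<Sum>j=1..CARD('n). real j * (ln 2 + ln (real j)))"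
    by (subst ln_prod) (auto simp: ln_realpow ln_mult_pos distrib_left intro!: sum.cong)
  moreover have "(\<Sum>j=1..CARD('n). real j * (ln 2 + ln (real j)))
      = (\<Sum>j=1..CARD('n). real j) * ln 2 + (\<Sum>j=1..CARD('n). real j * ln (real j))"
    by (simp add: distrib_left sum.distrib sum_distrib_right)
  moreover have "(\<Sum>j=1..CARD('n). real j) * ln 2 = real (CARD('n) * CARD('n)) * ln 2 - d * ln 2"
  proof -
    have "(\<Sum>j=1..CARD('n). real j) = real (CARD('n) * CARD('n)) - d"
      using double_gauss_sum_from_Suc_0[of "CARD('n)", where ?'a = real]
      by (simp add: d_def field_simps)
    then show ?thesis by (simp only: left_diff_distrib)
  qed
  ultimately show ?thesis unfolding discriminant by linarith
qed

lemma front_factor_limit: "(front_factor \<longlongrightarrow> limit_const) at_top"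
proof -
  let ?N = "real CARD('n)"
  \<comment> \<open>\<open>?R\<close> collects the Stirling remainders, counted
    \<open>1 + N - N\<close> times, so a single \<open>ln (sqrt (2 * pi))\<close> survives.
    \<open>?E\<close> is what is left of the elementary terms after the discriminant has cancelled
    the sum of \<open>j * ln j\<close>.\<close>
  let ?R = "\<lambda>k. stirling_rest (k * d + e) + ?N * stirling_rest k - (\<Sum>j=1..CARD('n). stirling_rest (real j * k))"
  let ?E = "\<lambda>k. (k * d + ?N / 2) * ln (k * d + e) - e - k * d * ln k - k * d * ln d - ?N / 2 * ln k"
  have *: "\<forall>\<^sub>F k in at_top. exp (?R k + ?E k - e * ln pi + ln (fact CARD('n)) / 2) = front_factor k"
    using eventually_gt_at_top[of 0]
  proof eventually_elim
    case (elim k)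
    have kd: "k * d + e > 0" using elim de_pos by (simp add: add_pos_pos)
    have "ln (front_factor k) = ln (norming_const k CARD('n)) - ?N / 2 * ln k - k * d * ln d
        + k * (\<Sum>(i, j)\<in>pairs. 2 * ln (z $ i - z $ j))"
    proof -
      have "(\<Prod>(i, j)\<in>pairs. (z $ i - z $ j) powr (2 * k)) > 0"
        by (intro prod_pos) (auto dest: zeros_strict)
      moreover have "ln (\<Prod>(i, j)\<in>pairs. (z $ i - z $ j) powr (2 * k)) = k * (\<Sum>(i, j)\<in>pairs. 2 * ln (z $ i - z $ j))"
        unfolding sum_distrib_left
        by (subst ln_prod) (auto dest: zeros_strict simp: ln_powr intro!: sum.cong)
      ultimately show ?thesis
        using norming_const_pos[OF elim] elim de_pos
        by (simp add: front_factor_def ln_mult_pos ln_powr)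
    qed
    moreover have "ln (norming_const k CARD('n)) = k * d * ln 2 + ln (fact CARD('n)) + ln (Gamma (k * d + e))
        - e * ln pi + ?N * ln (Gamma (1 + k)) - (\<Sum>j=1..CARD('n). ln (Gamma (1 + real j * k)))"
    proof -
      have g: "Gamma (1 + real j * k) > 0" "Gamma (1 + k) > 0" "Gamma (k * d + e) > 0" for j
        using elim kd by (auto intro!: Gamma_real_pos add_pos_nonneg)
      have "norming_const k CARD('n) = 2 powr (k * d) * fact CARD('n) * Gamma (k * d + e) / pi powr e
         * (\<Prod>j=1..CARD('n). Gamma (1 + k) / Gamma (1 + real j * k))"
        by (simp add: norming_const_def d_def e_def mult.assoc)
      moreover have "ln (\<Prod>j=1..CARD('n). Gamma (1 + k) / Gamma (1 + real j * k))
         = ?N * ln (Gamma (1 + k)) - (\<Sum>j=1..CARD('n). ln (Gamma (1 + real j * k)))"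
      proof -
        have "ln (\<Prod>j=1..CARD('n). Gamma (1 + k) / Gamma (1 + real j * k)) = (\<Sum>j=1..CARD('n). ln (Gamma (1 + k) / Gamma (1 + real j * k)))"
          using g less_imp_neq[OF g(1), symmetric] by (intro ln_prod) auto
        also have "\<dots> = (\<Sum>j=1..CARD('n). ln (Gamma (1 + k)) - ln (Gamma (1 + real j * k)))"
          using g by (intro sum.cong refl ln_divide_pos)
        finally show ?thesis by (simp add: sum_subtractf)
      qed
      moreover have "(\<Prod>j=1..CARD('n). Gamma (1 + k) / Gamma (1 + real j * k)) > 0"
        using g by (intro prod_pos) auto
      ultimately show ?thesis
        using g less_imp_neq[OF g(1), symmetric] by (simp add: ln_mult_pos ln_div ln_powr)
    qed
    moreover have "(\<Sum>j=1..CARD('n). ln (Gamma (1 + real j * k)))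
        = (\<Sum>j=1..CARD('n). stirling_rest (real j * k)) + k * (\<Sum>j=1..CARD('n). real j * ln (real j))
          + ln (fact CARD('n)) / 2 + (k * (d + ?N) + ?N / 2) * ln k - k * (d + ?N)"
    proof -
      have "(\<Sum>j=1..CARD('n). ln (Gamma (1 + real j * k))) = (\<Sum>j=1..CARD('n). stirling_rest (real j * k)
         + k * (real j * ln (real j)) + ln (real j) / 2 + real j * (k * ln k) + ln k / 2 - real j * k)"
        using elim by (intro sum.cong refl) (simp add: ln_Gamma_one_plus ln_mult_pos algebra_simps add_divide_distrib)
      also have "\<dots> = (\<Sum>j=1..CARD('n). stirling_rest (real j * k)) + k * (\<Sum>j=1..CARD('n). real j * ln (real j))
         + (\<Sum>j=1..CARD('n). ln (real j)) / 2 + (\<Sum>j=1..CARD('n). real j) * (k * ln k) + ?N * (ln k / 2)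
         - (\<Sum>j=1..CARD('n). real j) * k"
        by (simp only: sum.distrib sum_subtractf sum_distrib_left sum_distrib_right sum_divide_distrib) simp
      also have "(\<Sum>j=1..CARD('n). ln (real j)) = ln (fact CARD('n))"
        unfolding fact_prod of_nat_prod by (subst ln_prod) auto
      also have "(\<Sum>j=1..CARD('n). real j) = d + ?N"
        using double_gauss_sum_from_Suc_0[of "CARD('n)", where ?'a = real]
        by (simp add: d_def field_simps)
      finally show ?thesis by (simp add: algebra_simps)
    qed
    moreover have "ln (Gamma (k * d + e)) = stirling_rest (k * d + e) + (k * d + ?N / 2) * ln (k * d + e) - (k * d + e)"
      by (simp add: stirling_rest_def e_def add_divide_distrib)
    moreover note ln_Gamma_one_plus[OF elim] ln_discriminant
    ultimately have "ln (front_factor k) = ?R k + ?E k - e * ln pi + ln (fact CARD('n)) / 2"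
      by (simp add: algebra_simps)
    moreover have "front_factor k > 0"
      unfolding front_factor_def using norming_const_pos[OF elim] elim de_pos
      by (intro mult_pos_pos prod_pos) (auto dest: zeros_strict)
    ultimately show ?case by (metis exp_ln)
  qed
  have E: "(?E \<longlongrightarrow> ?N / 2 * ln d) at_top"
  proof -
    \<comment> \<open>With \<open>c = b / a\<close>, \<open>ln (k * a + b)\<close> splits into
      \<open>ln k + ln a + ln (1 + c / k)\<close>. The divergent parts cancel, and
      \<open>k * a * ln (1 + c / k)\<close> tends to \<open>b\<close>.\<close>
    have "((\<lambda>k. (k * a + b - 1/2) * ln (k * a + b) - b - k * a * ln k - k * a * ln a - (b - 1/2) * ln k) \<longlongrightarrow> (b - 1/2) * ln a) at_top"
      if "a > 0" "b > 0" for a b :: real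
    proof -
      define c where "c = b / a"
      have c: "c > 0" "b = a * c" using that by (simp_all add: c_def)
      have "((\<lambda>k. k * ln (1 + c / k)) \<longlongrightarrow> c) at_top" "((\<lambda>k. ln (1 + c / k)) \<longlongrightarrow> 0) at_top"
        using c(1) by real_asymp+
      then have "((\<lambda>k. a * (k * ln (1 + c / k)) + (b - 1/2) * ln (1 + c / k) - b + (b - 1/2) * ln a)
          \<longlongrightarrow> a * c + (b - 1/2) * 0 - b + (b - 1/2) * ln a) at_top"
        by (intro tendsto_intros)
      then have A: "((\<lambda>k. a * (k * ln (1 + c / k)) + (b - 1/2) * ln (1 + c / k) - b + (b - 1/2) * ln a)
          \<longlongrightarrow> (b - 1/2) * ln a) at_top"
        by (simp add: c(2))
      have B: "\<forall>\<^sub>F k in at_top. a * (k * ln (1 + c / k)) + (b - 1/2) * ln (1 + c / k) - b + (b - 1/2) * ln a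
         = (k * a + b - 1/2) * ln (k * a + b) - b - k * a * ln k - k * a * ln a - (b - 1/2) * ln k"
        using eventually_gt_at_top[of 0]
      proof eventually_elim
        case (elim k)
        have "k * a + b = k * a * (1 + c / k)" using elim c(2) by (simp add: field_simps)
        moreover have "1 + c / k > 0" using elim c(1) by (simp add: add_pos_pos)
        ultimately have L: "ln (k * a + b) = ln k + ln a + ln (1 + c / k)"
          using elim that by (simp add: ln_mult_pos)
        show ?case unfolding L by (simp add: algebra_simps)
      qed
      show ?thesis using A unfolding tendsto_cong[OF B] .
    qed
    from this[OF de_pos] show ?thesis by (simp add: e_def add_divide_distrib)
  qed
  have R: "(?R \<longlongrightarrow> ln (sqrt (2 * pi)) + ?N * ln (sqrt (2 * pi)) - (\<Sum>j=1..CARD('n). ln (sqrt (2 * pi)))) at_top"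
  proof (intro tendsto_intros stirling_rest_tendsto)
    have "LIM k at_top. k * a + b :> at_top" if "a > 0" for a b :: real
      using that by real_asymp
    from this[OF de_pos(1), of e] show "((\<lambda>k. stirling_rest (k * d + e)) \<longlongrightarrow> ln (sqrt (2 * pi))) at_top"
      by (rule filterlim_compose[OF stirling_rest_tendsto])
    show "((\<lambda>k. stirling_rest (real j * k)) \<longlongrightarrow> ln (sqrt (2 * pi))) at_top" if "j \<in> {1..CARD('n)}" for j
    proof -
      have "LIM k at_top. real j * k :> at_top"
        using that by (intro filterlim_tendsto_pos_mult_at_top[OF tendsto_const _ filterlim_ident]) auto
      then show ?thesis by (rule filterlim_compose[OF stirling_rest_tendsto])
    qed
  qed
  have "((\<lambda>k. exp (?R k + ?E k - e * ln pi + ln (fact CARD('n)) / 2)) \<longlongrightarrow>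
     exp (ln (sqrt (2 * pi)) + ?N * ln (sqrt (2 * pi)) - (\<Sum>j=1..CARD('n). ln (sqrt (2 * pi)))
        + ?N / 2 * ln d - e * ln pi + ln (fact CARD('n)) / 2)) at_top"
    by (intro tendsto_intros E R)
  moreover have "exp (ln (sqrt (2 * pi)) + ?N * ln (sqrt (2 * pi)) - (\<Sum>j=1..CARD('n). ln (sqrt (2 * pi)))
        + ?N / 2 * ln d - e * ln pi + ln (fact CARD('n)) / 2) = limit_const"
  proof -
    have pos: "limit_const > 0" using de_pos by (simp add: limit_const_def)
    have L: "ln limit_const = ln (fact CARD('n)) / 2 + ln 2 / 2 + ?N / 2 * ln d - ?N / 2 * ln pi"
      unfolding limit_const_def using de_pos by (simp add: ln_mult_pos ln_div ln_sqrt ln_powr)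
    have X: "ln (sqrt (2 * pi)) + ?N * ln (sqrt (2 * pi)) - (\<Sum>j=1..CARD('n). ln (sqrt (2 * pi)))
        + ?N / 2 * ln d - e * ln pi + ln (fact CARD('n)) / 2
      = ln limit_const"
      unfolding L by (simp add: e_def ln_sqrt ln_mult_pos add_divide_distrib distrib_right)
    show ?thesis unfolding X using pos by (rule exp_ln)
  qed
  ultimately show ?thesis unfolding tendsto_cong[OF *] by simp
qed

end

section \<open>Densities of the rescaled variables: factorization and majorant\<close>

lemma closed_weyl_chamber: "closed (weyl_chamber :: (real ^ 'n::{finite,linorder}) set)"
  unfolding weyl_chamber_def
  by (intro closed_Collect_all closed_Collect_imp open_Collect_const closed_Collect_le continuous_intros)

lemma measurable_beta_density [measurable]: "beta_density k \<in> borel_measurable borel"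
  unfolding beta_density_def case_prod_unfold by measurable

lemma zero_le_mult_cancel: "c > 0 \<Longrightarrow> 0 \<le> c * t \<longleftrightarrow> 0 \<le> t" for c t :: real
  by (simp add: zero_le_mult_iff)

lemma stretch_stretch: "stretch a z (stretch b z x) = stretch (a * b) z x"
  by (cases "z = 0")
     (simp_all add: stretch_eq inner_add_left power2_norm_eq_inner algebra_simps diff_divide_distrib add_divide_distrib)

lemma stretch_1: "stretch 1 z x = x"
  by (simp add: stretch_eq)

lemma rescaling_eq_stretch: "rescaling z k = stretch (1 / sqrt k) z"
  by (auto simp: rescaling_def stretch_def)

context freezing
begin

lemma pairs_nonempty: "pairs \<noteq> {}"
proof
  assume "pairs = {}"
  then have "d = 0" using norm_zeros_d(3) by (simp only: card.empty of_nat_0)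
  then show False using de_pos by simp
qed

text \<open>The density pulled back along the inverse of the rescaling, with Jacobian
  \<open>sqrt k\<close>. The indicator restricts the formula to the chamber, where its powers are
  meaningful.\<close>

definition scaled_density :: "real \<Rightarrow> real ^ 'n::_ \<Rightarrow> real" where
  "scaled_density k x = sqrt k * (indicator weyl_chamber (stretch (sqrt k) z x) * beta_density k (stretch (sqrt k) z x))"

lemma measurable_scaled_density [measurable]: "scaled_density k \<in> borel_measurable borel"
proof -
  have [measurable]: "(weyl_chamber :: (real ^ 'n::_) set) \<in> sets borel"
    using closed_weyl_chamber by (rule borel_closed)
  show ?thesis unfolding scaled_density_def by measurable
qed

lemma weyl_chamberD: "y \<in> weyl_chamber \<Longrightarrow> i < j \<Longrightarrow> y $ j \<le> y $ i"
  by (simp add: weyl_chamber_def)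

lemma weyl_chamberI: "(\<And>i j. i < j \<Longrightarrow> y $ j \<le> y $ i) \<Longrightarrow> y \<in> weyl_chamber"
  unfolding weyl_chamber_def by (auto simp: le_less)

lemma beta_density_nonneg: "k > 0 \<Longrightarrow> beta_density k (y :: real ^ 'n::_) \<ge> 0"
  unfolding beta_density_def using norming_const_pos[of k]
  by (intro mult_nonneg_nonneg prod_nonneg) auto

lemma scaled_density_nonneg: "k > 0 \<Longrightarrow> scaled_density k x \<ge> 0"
  using beta_density_nonneg by (simp add: scaled_density_def)

text \<open>In the chamber all difference quotients are nonnegative, yet their sum is a nonpositive
  multiple of 1; hence they vanish and so does the root product. The bounding hyperplane is
  included, so pointwise convergence will hold everywhere.\<close>

lemma scaled_density_outside:
  assumes k: "k > 0" and x: "x \<bullet> z \<le> 0"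
  shows "scaled_density k x = 0"
proof (cases "stretch (sqrt k) z x \<in> weyl_chamber")
  case True
  define y where "y = stretch (sqrt k) z x"
  have "y \<bullet> z = sqrt k * (x \<bullet> z)"
    using z_nonzero by (simp add: y_def stretch_eq inner_add_left power2_norm_eq_inner) (simp add: algebra_simps)
  then have "y \<bullet> z \<le> 0" using k x by (simp add: mult_nonneg_nonpos)
  then have "(\<Sum>(i, j)\<in>pairs. (y $ i - y $ j) / (z $ i - z $ j)) \<le> 0"
    by (simp add: sum_difference_quotients)
  moreover have "(\<Sum>(i, j)\<in>pairs. (y $ i - y $ j) / (z $ i - z $ j)) \<ge> 0"
    using weyl_chamberD[OF True[folded y_def]] zeros_strict by (intro sum_nonneg) (auto simp: less_imp_le)
  ultimately have "(\<Sum>(i, j)\<in>pairs. (y $ i - y $ j) / (z $ i - z $ j)) = 0" by linarith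
  then have 0: "\<forall>p\<in>pairs. (case p of (i, j) \<Rightarrow> (y $ i - y $ j) / (z $ i - z $ j)) = 0"
    using weyl_chamberD[OF True[folded y_def]] zeros_strict
    by (subst (asm) sum_nonneg_eq_0_iff) (auto simp: less_imp_le)
  obtain i j where ij: "(i, j) \<in> pairs" using pairs_nonempty by auto
  have "y $ i - y $ j = 0" using bspec[OF 0 ij] zeros_strict[of i j] ij by auto
  then have "(\<Prod>(i, j)\<in>pairs. (y $ i - y $ j) powr (2 * k)) = 0"
    using ij by (intro prod_zero) auto
  then show ?thesis by (simp add: scaled_density_def beta_density_def y_def)
qed (simp add: scaled_density_def)

text \<open>The \<open>u\<close> of the overview, since \<open>x \<bullet> z / d\<close> is the
  coefficient of \<open>z\<close> in \<open>x\<close>. On the hyperplane orthogonal to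
  \<open>z\<close> division by zero gives 0, so \<open>sum_rel_diff\<close> holds there too.\<close>

definition rel_diff :: "real ^ 'n::_ \<Rightarrow> 'n \<Rightarrow> 'n \<Rightarrow> real" where
  "rel_diff x i j = (proj_perp z x $ i - proj_perp z x $ j) / ((x \<bullet> z / d) * (z $ i - z $ j))"

text \<open>These are the \<open>p\<close> and \<open>s\<close> of \<open>radial_bound\<close>. The
  1 in \<open>1 + (norm y)^2\<close> is put with the orthogonal part, which makes
  \<open>perp_sq\<close> positive everywhere.\<close>

definition line_sq :: "real ^ 'n::_ \<Rightarrow> real" where "line_sq x = (x \<bullet> z)\<^sup>2 / d"
definition perp_sq :: "real ^ 'n::_ \<Rightarrow> real" where "perp_sq x = 1 + (norm (proj_perp z x))\<^sup>2"

lemma proj_perp_inner: "proj_perp z x \<bullet> z = 0"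
  using norm_zeros_d de_pos by (simp add: proj_perp_def proj_line_def inner_diff_left)

lemma sum_rel_diff: "(\<Sum>(i, j)\<in>pairs. rel_diff x i j) = 0"
proof -
  have "(\<Sum>(i, j)\<in>pairs. rel_diff x i j) =
      (\<Sum>(i, j)\<in>pairs. (proj_perp z x $ i - proj_perp z x $ j) / (z $ i - z $ j)) / (x \<bullet> z / d)"
    unfolding sum_divide_distrib rel_diff_def by (intro sum.cong) (auto simp: mult.commute)
  then show ?thesis by (simp add: sum_difference_quotients proj_perp_inner)
qed

lemma norm_stretch: "(norm (stretch c z x))\<^sup>2 = c\<^sup>2 * line_sq x + (norm (proj_perp z x))\<^sup>2"
proof -
  have "orthogonal (c *\<^sub>R proj_line z x) (proj_perp z x)"
    using proj_perp_inner[of x] by (simp add: orthogonal_def proj_line_def inner_commute)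
  then have "(norm (stretch c z x))\<^sup>2 = (norm (c *\<^sub>R proj_line z x))\<^sup>2 + (norm (proj_perp z x))\<^sup>2"
    unfolding stretch_def by (rule norm_add_Pythagorean)
  also have "(norm (c *\<^sub>R proj_line z x))\<^sup>2 = c\<^sup>2 * line_sq x"
    using norm_zeros_d de_pos
    by (simp add: proj_line_def line_sq_def power_mult_distrib power_divide) (simp add: power2_eq_square)
  finally show ?thesis .
qed

lemma perp_sq_add_line_sq: "perp_sq x + line_sq x = 1 + (norm x)\<^sup>2"
  using norm_stretch[of 1 x] by (simp add: perp_sq_def stretch_1)

lemma perp_sq_pos: "perp_sq x > 0"
  by (simp add: perp_sq_def add_pos_nonneg)

lemma line_sq_pos: "x \<bullet> z > 0 \<Longrightarrow> line_sq x > 0"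
  using de_pos by (simp add: line_sq_def)

context
  fixes k :: real and x :: "real ^ 'n::_"
  assumes k: "k > 0" and x: "x \<bullet> z > 0"
begin

lemma stretch_diff:
  assumes "i < j"
  shows "stretch (sqrt k) z x $ i - stretch (sqrt k) z x $ j =
    (sqrt k * (x \<bullet> z / d)) * (z $ i - z $ j) * (1 + rel_diff x i j / sqrt k)"
proof -
  have "z $ i - z $ j > 0" using zeros_strict[OF assms] by simp
  then show ?thesis
    using k x de_pos norm_zeros_d(1)
    by (simp add: rel_diff_def stretch_def proj_line_def field_simps)
qed

lemma stretch_in_chamber_iff:
  "stretch (sqrt k) z x \<in> weyl_chamber \<longleftrightarrow> (\<forall>(i, j)\<in>pairs. 1 + rel_diff x i j / sqrt k \<ge> 0)"
proof -
  have "stretch (sqrt k) z x $ j \<le> stretch (sqrt k) z x $ i \<longleftrightarrow> 1 + rel_diff x i j / sqrt k \<ge> 0" if "i < j" for i j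
  proof -
    have "(sqrt k * (x \<bullet> z / d)) * (z $ i - z $ j) > 0"
      using k x de_pos zeros_strict[OF that] by simp
    then have "0 \<le> stretch (sqrt k) z x $ i - stretch (sqrt k) z x $ j \<longleftrightarrow> 1 + rel_diff x i j / sqrt k \<ge> 0"
      unfolding stretch_diff[OF that] by (rule zero_le_mult_cancel)
    then show ?thesis by simp
  qed
  then show ?thesis by (auto intro: weyl_chamberI dest: weyl_chamberD)
qed

lemma scaled_density_formula:
  assumes "stretch (sqrt k) z x \<in> weyl_chamber"
  shows "scaled_density k x = front_factor k * (k powr e * (k * line_sq x) powr (k * d) * (perp_sq x + k * line_sq x) powr - (k * d + e))
    * (\<Prod>(i, j)\<in>pairs. (1 + rel_diff x i j / sqrt k) powr (2 * k))"
proof -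
  let ?y = "stretch (sqrt k) z x" and ?a = "x \<bullet> z / d"
  have a: "sqrt k * ?a > 0" using k x de_pos by simp
  have "(\<Prod>(i, j)\<in>pairs. (?y $ i - ?y $ j) powr (2 * k)) =
     (\<Prod>(i, j)\<in>pairs. (sqrt k * ?a) powr (2 * k) * (z $ i - z $ j) powr (2 * k) * (1 + rel_diff x i j / sqrt k) powr (2 * k))"
    by (intro prod.cong refl) (clarify, simp only: stretch_diff powr_mult)
  also have "\<dots> = (\<Prod>p\<in>pairs. (sqrt k * ?a) powr (2 * k)) * (\<Prod>(i, j)\<in>pairs. (z $ i - z $ j) powr (2 * k))
     * (\<Prod>(i, j)\<in>pairs. (1 + rel_diff x i j / sqrt k) powr (2 * k))"
    by (simp add: prod.distrib case_prod_unfold)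
  \<comment> \<open>One factor for each of the \<open>d\<close> pairs. The square of
    \<open>sqrt k * ?a\<close> is \<open>k * line_sq x / d\<close> because
    \<open>(norm z)^2 = d\<close>.\<close>
  also have "(\<Prod>p\<in>pairs. (sqrt k * ?a) powr (2 * k)) = (k * line_sq x) powr (k * d) * d powr - (k * d)"
  proof -
    have "(\<Prod>p\<in>pairs. (sqrt k * ?a) powr (2 * k)) = ((sqrt k * ?a) powr (2 * k)) powr d"
    proof -
      have "((sqrt k * ?a) powr (2 * k)) ^ card pairs = ((sqrt k * ?a) powr (2 * k)) powr real (card pairs)"
        using k x de_pos by (intro powr_realpow[symmetric]) simp
      then show ?thesis unfolding norm_zeros_d(3) by simp
    qed
    also have "\<dots> = ((sqrt k * ?a) powr 2) powr (k * d)"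
      by (simp add: powr_powr mult.assoc)
    also have "(sqrt k * ?a) powr 2 = (k * line_sq x) / d"
      using k a de_pos by (simp add: power_mult_distrib line_sq_def power_divide) (simp add: power2_eq_square)
    also have "\<dots> powr (k * d) = (k * line_sq x) powr (k * d) * d powr - (k * d)"
      using de_pos k line_sq_pos[OF x] by (simp add: powr_divide powr_minus_divide)
    finally show ?thesis .
  qed
  finally have P: "(\<Prod>(i, j)\<in>pairs. (?y $ i - ?y $ j) powr (2 * k)) =
     (k * line_sq x) powr (k * d) * d powr - (k * d) * (\<Prod>(i, j)\<in>pairs. (z $ i - z $ j) powr (2 * k))
     * (\<Prod>(i, j)\<in>pairs. (1 + rel_diff x i j / sqrt k) powr (2 * k))" .
  have S: "1 + (norm ?y)\<^sup>2 = perp_sq x + k * line_sq x"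
    using k by (simp add: norm_stretch perp_sq_def)
  have K: "sqrt k = k powr - (real CARD('n) / 2) * k powr e"
    using k by (simp add: e_def powr_half_sqrt flip: powr_add) (simp add: add_divide_distrib powr_half_sqrt)
  have B: "beta_density k ?y = norming_const k CARD('n) * (perp_sq x + k * line_sq x) powr - (k * d + e) *
     (\<Prod>(i, j)\<in>pairs. (?y $ i - ?y $ j) powr (2 * k))"
    unfolding beta_density_def S powr_minus_divide by (simp add: d_def e_def mult.assoc)
  have "scaled_density k x = (k powr - (real CARD('n) / 2) * k powr e) * beta_density k ?y"
    using assms by (simp add: scaled_density_def flip: K)
  then show ?thesis
    unfolding B P front_factor_def by (simp only: mult_ac)
qed

text \<open>Each root factor is at most the exponential of its linear term, and these exponentials
  multiply to 1 by \<open>sum_rel_diff\<close>. Outside the chamber the density is 0.\<close>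

lemma scaled_density_bound:
  "scaled_density k x \<le> front_factor k * ((1 + e / d) powr e * (1 + (norm x)\<^sup>2) powr - e)"
proof (cases "stretch (sqrt k) z x \<in> weyl_chamber")
  case True
  have pos: "1 + rel_diff x i j / sqrt k \<ge> 0" if "i < j" for i j
    using True that unfolding stretch_in_chamber_iff by auto
  have "(\<Prod>(i, j)\<in>pairs. (1 + rel_diff x i j / sqrt k) powr (2 * k)) \<le> (\<Prod>(i, j)\<in>pairs. exp (2 * k * (rel_diff x i j / sqrt k)))"
  proof (intro prod_mono, clarify, intro conjI)
    fix i j :: 'n assume "i < j"
    show "(1 + rel_diff x i j / sqrt k) powr (2 * k) \<le> exp (2 * k * (rel_diff x i j / sqrt k))"
      using k by (intro powr_le_exp_mult pos \<open>i < j\<close>) auto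
  qed simp
  also have "\<dots> = exp (\<Sum>(i, j)\<in>pairs. 2 * k * (rel_diff x i j / sqrt k))"
    by (simp add: exp_sum case_prod_unfold)
  also have "(\<Sum>(i, j)\<in>pairs. 2 * k * (rel_diff x i j / sqrt k)) = 2 * k / sqrt k * (\<Sum>(i, j)\<in>pairs. rel_diff x i j)"
    unfolding sum_distrib_left by (intro sum.cong) auto
  finally have P: "(\<Prod>(i, j)\<in>pairs. (1 + rel_diff x i j / sqrt k) powr (2 * k)) \<le> 1" by (simp add: sum_rel_diff)
  have c: "front_factor k \<ge> 0" using norming_const_pos[OF k] 
    by (auto simp: front_factor_def case_prod_unfold intro!: mult_nonneg_nonneg prod_nonneg)
  have "scaled_density k x \<le> front_factor k * ((1 + e / d) powr e * (perp_sq x + line_sq x) powr - e) * 1"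
    unfolding scaled_density_formula[OF True]
    by (rule mult_mono[OF mult_left_mono[OF radial_bound[OF k line_sq_pos[OF x] perp_sq_pos de_pos] c] P])
       (use c in \<open>auto intro!: mult_nonneg_nonneg prod_nonneg\<close>)
  then show ?thesis by (simp add: perp_sq_add_line_sq)
next
  case False
  have "front_factor k \<ge> 0" using norming_const_pos[OF k] 
    by (auto simp: front_factor_def case_prod_unfold intro!: mult_nonneg_nonneg prod_nonneg)
  with False show ?thesis by (simp add: scaled_density_def)
qed

end

section \<open>The limit density and dominated convergence\<close>

lemma limit_density_formula:
  assumes x: "x \<bullet> z > 0"
  shows "limit_density z x = limit_const * (line_sq x powr - e * exp (- d * perp_sq x / line_sq x)) * (\<Prod>(i, j)\<in>pairs. exp (- (rel_diff x i j)\<^sup>2))"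
proof -
  let ?n = "real CARD('n)"
  define a where "a = x \<bullet> z / d"
  define w where "w = proj_perp z x"
  define S where "S = (\<Sum>(i, j)\<in>pairs. (rel_diff x i j)\<^sup>2)"
  have a: "a > 0" using x de_pos by (simp add: a_def)
  have pa: "line_sq x = a\<^sup>2 * d" using de_pos by (simp add: line_sq_def a_def power2_eq_square)
  have p: "line_sq x > 0" using a de_pos by (simp add: pa)
  have pn: "norm (proj_line z x) = sqrt (line_sq x)"
    using norm_stretch[of 1 "proj_line z x"] norm_zeros_d de_pos a
    by (simp add: proj_line_def a_def[symmetric] pa real_sqrt_mult norm_eq_sqrt_inner)
  have xa: "x = a *\<^sub>R z + w"
    by (simp add: w_def proj_perp_def proj_line_def a_def norm_zeros_d)
  \<comment> \<open>Expanding the square, the cross terms vanish by \<open>sum_rel_diff\<close> and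
    the constant terms count the pairs.\<close>
  have Q: "(\<Sum>(i, j)\<in>pairs. (x $ i - x $ j)\<^sup>2 / (z $ i - z $ j)\<^sup>2) = a\<^sup>2 * (d + S)"
  proof -
    have "(\<Sum>(i, j)\<in>pairs. (x $ i - x $ j)\<^sup>2 / (z $ i - z $ j)\<^sup>2) = (\<Sum>(i, j)\<in>pairs. a\<^sup>2 * (1 + 2 * rel_diff x i j + (rel_diff x i j)\<^sup>2))"
    proof (intro sum.cong refl, clarify)
      fix i j :: 'n assume "i < j"
      then have zz: "z $ i - z $ j \<noteq> 0" using zeros_strict[of i j] by simp
      have uw: "w $ i - w $ j = a * (z $ i - z $ j) * rel_diff x i j"
        using zz x de_pos by (simp add: rel_diff_def w_def a_def)
      have "x $ i - x $ j = a * (z $ i - z $ j) + (w $ i - w $ j)"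
        by (subst (1 2) xa) (simp add: algebra_simps)
      also have "\<dots> = (z $ i - z $ j) * (a * (1 + rel_diff x i j))"
        unfolding uw by (simp add: algebra_simps)
      finally have "(x $ i - x $ j)\<^sup>2 / (z $ i - z $ j)\<^sup>2 = (a * (1 + rel_diff x i j))\<^sup>2"
        using zz by (simp add: power_mult_distrib)
      then show "(x $ i - x $ j)\<^sup>2 / (z $ i - z $ j)\<^sup>2 = a\<^sup>2 * (1 + 2 * rel_diff x i j + (rel_diff x i j)\<^sup>2)"
        by (simp add: power_mult_distrib power2_sum)
    qed
    also have "\<dots> = a\<^sup>2 * (real (card pairs) + 2 * (\<Sum>(i, j)\<in>pairs. rel_diff x i j) + S)"
    proof -
      have "(\<Sum>p\<in>pairs. a\<^sup>2 * (1 + 2 * f p + (f p)\<^sup>2))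
        = a\<^sup>2 * (real (card pairs) + 2 * (\<Sum>p\<in>pairs. f p) + (\<Sum>p\<in>pairs. (f p)\<^sup>2))" for f
        by (simp add: sum.distrib flip: sum_distrib_left)
      from this[of "\<lambda>p. rel_diff x (fst p) (snd p)"] show ?thesis by (simp add: case_prod_unfold S_def)
    qed
    finally show ?thesis by (simp add: sum_rel_diff norm_zeros_d)
  qed
  have nx: "(norm x)\<^sup>2 = line_sq x + perp_sq x - 1" using perp_sq_add_line_sq[of x] by simp
  have "limit_density z x = sqrt (fact CARD('n)) * (2 * d) powr (?n / 2) * exp (2 * d) / (pi powr (?n / 2) * 2 powr ((?n - 1) / 2))
     * exp (- (d / line_sq x) * (a\<^sup>2 * (d + S) + (line_sq x + perp_sq x - 1))) * exp (- (2 * d) / (2 * line_sq x)) * (1 / sqrt (line_sq x) ^ (CARD('n) + 1))"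
    using p unfolding limit_density_def Let_def pn Q nx norm_zeros_d
    by (simp add: d_def)
  also have "1 / sqrt (line_sq x) ^ (CARD('n) + 1) = line_sq x powr - e"
  proof -
    have "sqrt (line_sq x) ^ (CARD('n) + 1) = (line_sq x powr (1/2)) powr (real (CARD('n) + 1))"
      using p by (subst powr_realpow) (simp_all add: powr_half_sqrt)
    also have "\<dots> = line_sq x powr e" unfolding powr_powr e_def by (simp add: add.commute)
    finally show ?thesis by (simp add: powr_minus_divide)
  qed
  \<comment> \<open>The pair sum and the norm each contribute \<open>- d\<close>, which together
    cancel \<open>exp (2 * d)\<close>. The remaining \<open>d / line_sq x\<close> stems from the 1
    in \<open>perp_sq\<close> and cancels the separate exponential factor of the density.\<close>
  also have "- (d / line_sq x) * (a\<^sup>2 * (d + S) + (line_sq x + perp_sq x - 1)) = - (2 * d) - S - d * perp_sq x / line_sq x + d / line_sq x"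
    using a de_pos unfolding pa by (simp add: field_simps)
  also have "sqrt (fact CARD('n)) * (2 * d) powr (?n / 2) * exp (2 * d) / (pi powr (?n / 2) * 2 powr ((?n - 1) / 2))
     = limit_const * exp (2 * d)"
  proof -
    have "(2::real) powr (?n / 2) = 2 powr ((?n - 1) / 2) * sqrt 2"
      unfolding powr_half_sqrt[symmetric, of 2, simplified] powr_add[symmetric] by (simp add: diff_divide_distrib)
    then show ?thesis using de_pos by (simp add: limit_const_def powr_mult)
  qed
  also have "limit_const * exp (2 * d) * exp (- (2 * d) - S - d * perp_sq x / line_sq x + d / line_sq x) * exp (- (2 * d) / (2 * line_sq x)) * line_sq x powr - e
    = limit_const * (line_sq x powr - e * exp (- d * perp_sq x / line_sq x)) * exp (- S)"
    by (simp add: exp_add exp_diff exp_minus field_simps)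
  also have "exp (- S) = (\<Prod>(i, j)\<in>pairs. exp (- (rel_diff x i j)\<^sup>2))"
    by (simp add: S_def exp_sum case_prod_unfold flip: sum_negf)
  finally show ?thesis .
qed

text \<open>For fixed \<open>x\<close> the stretched point lies in the chamber for all large
  \<open>k\<close>. The linear exponentials can be split off the root factors because they multiply
  to 1, after which every factor has a limit.\<close>

lemma scaled_density_limit:
  assumes x: "x \<bullet> z > 0"
  shows "((\<lambda>k. scaled_density k x) \<longlongrightarrow> limit_density z x) at_top"
proof -
  let ?P = "\<lambda>k. \<Prod>(i, j)\<in>pairs. exp (2 * k * (ln (1 + rel_diff x i j / sqrt k) - rel_diff x i j / sqrt k))"
  let ?h = "\<lambda>k. front_factor k * (k powr e * (k * line_sq x) powr (k * d) * (perp_sq x + k * line_sq x) powr - (k * d + e)) * ?P k"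
  have "(?h \<longlongrightarrow> limit_density z x) at_top"
    unfolding limit_density_formula[OF x] case_prod_unfold
    by (rule tendsto_mult[OF tendsto_mult[OF front_factor_limit radial_limit[OF line_sq_pos[OF x] perp_sq_pos de_pos(1)]]
          tendsto_prod[OF root_factor_limit]])
  moreover have "\<forall>\<^sub>F k in at_top. scaled_density k x = ?h k"
  proof -
    have "\<forall>\<^sub>F k in at_top. 1 + rel_diff x i j / sqrt k > 0" for i j
    proof -
      have "((\<lambda>k. 1 + rel_diff x i j / sqrt k) \<longlongrightarrow> 1) at_top" by real_asymp
      then show ?thesis by (rule order_tendstoD) simp
    qed
    then have "\<forall>\<^sub>F k in at_top. \<forall>p\<in>pairs. 1 + rel_diff x (fst p) (snd p) / sqrt k > 0"
      by (subst eventually_ball_finite_distrib) auto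
    then show ?thesis using eventually_gt_at_top[of 0]
    proof eventually_elim
      case (elim k)
      have "stretch (sqrt k) z x \<in> weyl_chamber"
        using elim unfolding stretch_in_chamber_iff[OF elim(2) x] by (auto simp: less_imp_le)
      moreover have "(\<Prod>(i, j)\<in>pairs. (1 + rel_diff x i j / sqrt k) powr (2 * k)) = ?P k"
      proof -
        have "(\<Prod>(i, j)\<in>pairs. (1 + rel_diff x i j / sqrt k) powr (2 * k)) = 
          (\<Prod>(i, j)\<in>pairs. exp (2 * k * (ln (1 + rel_diff x i j / sqrt k) - rel_diff x i j / sqrt k)) * exp (2 * k * (rel_diff x i j / sqrt k)))"
        proof (intro prod.cong refl, clarify)
          fix i j :: 'n assume "i < j"
          then have "1 + rel_diff x i j / sqrt k > 0" using elim(1) by auto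
          then show "(1 + rel_diff x i j / sqrt k) powr (2 * k) =
              exp (2 * k * (ln (1 + rel_diff x i j / sqrt k) - rel_diff x i j / sqrt k)) * exp (2 * k * (rel_diff x i j / sqrt k))"
            by (simp add: powr_def mult_exp_exp right_diff_distrib)
        qed
        also have "\<dots> = ?P k * (\<Prod>(i, j)\<in>pairs. exp (2 * k * (rel_diff x i j / sqrt k)))"
          by (simp add: prod.distrib case_prod_unfold)
        also have "(\<Prod>(i, j)\<in>pairs. exp (2 * k * (rel_diff x i j / sqrt k))) = exp (2 * k / sqrt k * (\<Sum>(i, j)\<in>pairs. rel_diff x i j))"
          unfolding sum_distrib_left by (simp add: exp_sum case_prod_unfold)
        finally show ?thesis by (simp add: sum_rel_diff)
      qed
      ultimately show ?case by (simp add: scaled_density_formula[OF elim(2) x])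
    qed
  qed
  ultimately show ?thesis by (subst tendsto_cong)
qed

definition limit_fun :: "real ^ 'n::_ \<Rightarrow> real" where
  "limit_fun x = indicator (interior (half_space z)) x * limit_density z x"

lemma interior_half_space: "interior (half_space z) = {x. x \<bullet> z > 0}"
  using interior_halfspace_ge[OF z_nonzero, of 0] by (simp add: half_space_def inner_commute)

lemma limit_const_pos: "limit_const > 0"
  using de_pos by (simp add: limit_const_def)

lemma limit_fun_pos: "x \<bullet> z > 0 \<Longrightarrow> limit_fun x > 0"
  using line_sq_pos[of x] limit_const_pos
  by (auto simp: limit_fun_def interior_half_space limit_density_formula intro!: mult_pos_pos prod_pos)

lemma limit_fun_outside: "x \<bullet> z \<le> 0 \<Longrightarrow> limit_fun x = 0"
  by (simp add: limit_fun_def interior_half_space)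

lemma limit_fun_nonneg: "limit_fun x \<ge> 0"
  using limit_fun_pos[of x] limit_fun_outside[of x] by linarith

lemma measurable_limit_fun [measurable]: "limit_fun \<in> borel_measurable borel"
  unfolding limit_fun_def limit_density_def Let_def proj_line_def case_prod_unfold by measurable

lemma scaled_density_tendsto: "((\<lambda>k. scaled_density k x) \<longlongrightarrow> limit_fun x) at_top"
proof (cases "x \<bullet> z > 0")
  case True
  then show ?thesis using scaled_density_limit[OF True] by (simp add: limit_fun_def interior_half_space)
next
  case False
  have "\<forall>\<^sub>F k in at_top. scaled_density k x = 0"
    using eventually_gt_at_top[of 0] by eventually_elim (use False in \<open>simp add: scaled_density_outside\<close>)
  then show ?thesis using False by (simp add: tendsto_cong limit_fun_outside)
qed

lemma scaled_integral_tendsto: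
  fixes g :: "real ^ 'n::_ \<Rightarrow> real"
  assumes [measurable]: "g \<in> borel_measurable borel" and b: "\<And>x. \<bar>g x\<bar> \<le> b"
  shows "integrable lborel (\<lambda>x. limit_fun x * g x)"
    and "((\<lambda>k. \<integral>x. scaled_density k x * g x \<partial>lborel) \<longlongrightarrow> (\<integral>x. limit_fun x * g x \<partial>lborel)) at_top"
proof -
  \<comment> \<open>\<open>limit_const + 1\<close> bounds \<open>front_factor k\<close> for all
    large \<open>k\<close>; the other factor is the constant of \<open>radial_bound\<close>.\<close>
  define K where "K = (limit_const + 1) * (1 + e / d) powr e"
  let ?w = "\<lambda>x :: real ^ 'n::_. b * K * (1 + (norm x)\<^sup>2) powr - e"
  have "integrable lborel (\<lambda>x :: real ^ 'n::_. (1 + (norm x)\<^sup>2) powr - e)"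
    using integrable_Cauchy_tail[where 'a = "real ^ 'n::_"] by (simp add: e_def minus_divide_left)
  then have w: "integrable lborel ?w" by (intro integrable_mult_right)
  have "\<forall>\<^sub>F k in at_top. front_factor k < limit_const + 1"
    using front_factor_limit by (rule order_tendstoD) simp
  then have bound: "\<forall>\<^sub>F k in at_top. AE x in lborel. norm (scaled_density k x * g x) \<le> ?w x"
    using eventually_gt_at_top[of 0]
  proof eventually_elim
    case (elim k)
    have lc: "limit_const + 1 > 0" using limit_const_pos by linarith
    have "norm (scaled_density k x * g x) \<le> ?w x" for x
    proof -
      have "scaled_density k x \<le> K * (1 + (norm x)\<^sup>2) powr - e"
      proof (cases "x \<bullet> z > 0")
        case True
        have "scaled_density k x \<le> front_factor k * ((1 + e / d) powr e * (1 + (norm x)\<^sup>2) powr - e)"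
          by (rule scaled_density_bound[OF elim(2) True])
        also have "\<dots> \<le> (limit_const + 1) * ((1 + e / d) powr e * (1 + (norm x)\<^sup>2) powr - e)"
          using elim by (intro mult_right_mono) auto
        finally show ?thesis by (simp add: K_def mult.assoc)
      next
        case False
        then show ?thesis using lc scaled_density_outside[OF elim(2), of x] by (simp add: K_def)
      qed
      then have "\<bar>scaled_density k x\<bar> * \<bar>g x\<bar> \<le> (K * (1 + (norm x)\<^sup>2) powr - e) * b"
        using scaled_density_nonneg[OF elim(2), of x] b[of x] by (intro mult_mono) auto
      then show ?thesis by (simp add: abs_mult mult_ac)
    qed
    then show ?case by simp
  qed
  have lim: "AE x in lborel. ((\<lambda>k. scaled_density k x * g x) \<longlongrightarrow> limit_fun x * g x) at_top"
    by (intro AE_I2 tendsto_mult_right scaled_density_tendsto)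
  show "((\<lambda>k. \<integral>x. scaled_density k x * g x \<partial>lborel) \<longlongrightarrow> (\<integral>x. limit_fun x * g x \<partial>lborel)) at_top"
    by (rule integral_dominated_convergence_at_top[OF _ _ w lim bound]) measurable
  show "integrable lborel (\<lambda>x. limit_fun x * g x)"
    by (rule integrable_dominated_convergence_at_top[OF _ _ w lim bound]) measurable
qed

end

section \<open>Laws of the rescaled variables, mass and support of the limit\<close>

text \<open>The restricted Lebesgue measure becomes an indicator, and the substitution by
  \<open>stretch (sqrt k) z\<close> undoes the rescaling inside the event.\<close>

lemma distr_rescaled:
  fixes z :: "real ^ 'n::{finite,linorder}" and X :: "'w \<Rightarrow> real ^ 'n::_"
  assumes f: "freezing z" and k: "k > 0"
    and X: "distributed M (restrict_space lborel weyl_chamber) X (\<lambda>y. ennreal (beta_density k y))"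
  shows "distr M borel (\<lambda>\<omega>. rescaling z k (X \<omega>)) = density lborel (\<lambda>x. ennreal (freezing.scaled_density z k x))"
proof -
  interpret freezing z by fact
  let ?W = "weyl_chamber :: (real ^ 'n::_) set" and ?R = "restrict_space lborel (weyl_chamber :: (real ^ 'n::_) set)"
  have W [measurable]: "?W \<in> sets borel"
    using closed_weyl_chamber by (rule borel_closed)
  have Xm: "X \<in> measurable M ?R" and Xd: "distr M ?R X = density ?R (\<lambda>y. ennreal (beta_density k y))"
    using X by (auto simp: distributed_def)
  have [measurable]: "rescaling z k \<in> borel_measurable borel"
    by (simp add: rescaling_eq_stretch)
  have rR: "rescaling z k \<in> measurable ?R borel"
    by (rule measurable_restrict_space1) simp
  have "distr M borel (\<lambda>\<omega>. rescaling z k (X \<omega>)) = distr (distr M ?R X) borel (rescaling z k)"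
    using Xm rR by (simp add: distr_distr o_def)
  also have "\<dots> = density lborel (\<lambda>x. ennreal (scaled_density k x))"
  proof (rule measure_eqI)
    fix A assume "A \<in> sets (distr (distr M ?R X) borel (rescaling z k))"
    then have A [measurable]: "A \<in> sets borel" by simp
    have A': "rescaling z k -` A \<inter> space ?R \<in> sets ?R"
      using measurable_sets[OF rR A] .
    have "emeasure (distr (distr M ?R X) borel (rescaling z k)) A
       = emeasure (density ?R (\<lambda>y. ennreal (beta_density k y))) (rescaling z k -` A \<inter> space ?R)"
      using rR unfolding Xd by (subst emeasure_distr) auto
    also have "\<dots> = (\<integral>\<^sup>+y. ennreal (beta_density k y) * indicator (rescaling z k -` A \<inter> space ?R) y \<partial>?R)"
      by (intro emeasure_density A' measurable_restrict_space1) simp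
    also have "\<dots> = (\<integral>\<^sup>+y. ennreal (beta_density k y) * indicator (rescaling z k -` A \<inter> space ?R) y * indicator ?W y \<partial>lborel)"
      by (subst nn_integral_restrict_space) auto
    also have "\<dots> = (\<integral>\<^sup>+y. ennreal (indicator ?W y * beta_density k y) * indicator A (rescaling z k y) \<partial>lborel)"
      by (intro nn_integral_cong) (auto simp: indicator_def space_restrict_space)
    also have "\<dots> = (\<integral>\<^sup>+x. ennreal (sqrt k) * (ennreal (indicator ?W (stretch (sqrt k) z x) * beta_density k (stretch (sqrt k) z x))
        * indicator A (rescaling z k (stretch (sqrt k) z x))) \<partial>lborel)"
      using k z_nonzero by (intro nn_integral_stretch) auto
    also have "\<dots> = (\<integral>\<^sup>+x. ennreal (scaled_density k x) * indicator A x \<partial>lborel)"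
    proof (intro nn_integral_cong)
      fix x
      have "rescaling z k (stretch (sqrt k) z x) = x"
        using k by (simp add: rescaling_eq_stretch stretch_stretch stretch_1)
      then show "ennreal (sqrt k) * (ennreal (indicator ?W (stretch (sqrt k) z x) * beta_density k (stretch (sqrt k) z x))
        * indicator A (rescaling z k (stretch (sqrt k) z x))) = ennreal (scaled_density k x) * indicator A x"
        using k beta_density_nonneg[OF k] by (simp add: scaled_density_def ennreal_mult mult.assoc)
    qed
    also have "\<dots> = emeasure (density lborel (\<lambda>x. ennreal (scaled_density k x))) A"
      by (subst emeasure_density) auto
    finally show "emeasure (distr (distr M ?R X) borel (rescaling z k)) A = emeasure (density lborel (\<lambda>x. ennreal (scaled_density k x))) A" .
  qed simp
  finally show ?thesis .
qed

theorem theorem3p8: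
  fixes z :: "real ^ 'n::{finite,linorder}"
    and M :: "real \<Rightarrow> 'w measure"
    and X :: "real \<Rightarrow> 'w \<Rightarrow> real ^ 'n::{finite,linorder}"
  assumes "CARD('n) \<ge> 2"
    and "ordered_hermite_zeros z"
    and "\<And>k. k > 0 \<Longrightarrow> prob_space (M k)"
    and "\<And>k. k > 0 \<Longrightarrow>
           distributed (M k) (restrict_space lborel weyl_chamber) (X k)
             (\<lambda>y. ennreal (beta_density k y))"
  shows "\<exists>\<mu> :: (real ^ 'n::{finite,linorder}) measure.
           prob_space \<mu> \<and> sets \<mu> = sets borel
         \<and> converges_in_distribution M (\<lambda>k \<omega>. rescaling z k (X k \<omega>)) \<mu> at_top
         \<and> topological_support \<mu> = half_space z
         \<and> \<mu> = density lborel
                 (\<lambda>y. ennreal (indicator (interior (half_space z)) y * limit_density z y))"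
proof -
  interpret freezing z
    using assms(1,2) by unfold_locales
  define \<mu> where "\<mu> = density lborel (\<lambda>y. ennreal (limit_fun y))"
  let ?d = "\<lambda>k. distr (M k) borel (\<lambda>\<omega>. rescaling z k (X k \<omega>))"
  have D: "?d k = density lborel (\<lambda>x. ennreal (scaled_density k x))" if "k > 0" for k
    using distr_rescaled[OF freezing_axioms that assms(4)[OF that]] .
  have I: "integral\<^sup>L (?d k) g = (\<integral>x. scaled_density k x * g x \<partial>lborel)"
    if "k > 0" and [measurable]: "g \<in> borel_measurable borel" for k and g :: "real ^ 'n::_ \<Rightarrow> real"
    unfolding D[OF that(1)] using scaled_density_nonneg[OF that(1)]
    by (subst integral_density) auto
  have I': "integral\<^sup>L \<mu> g = (\<integral>x. limit_fun x * g x \<partial>lborel)"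
    if [measurable]: "g \<in> borel_measurable borel" for g :: "real ^ 'n::_ \<Rightarrow> real"
    unfolding \<mu>_def using limit_fun_nonneg by (subst integral_density) auto
  have conv: "((\<lambda>k. integral\<^sup>L (?d k) g) \<longlongrightarrow> integral\<^sup>L \<mu> g) at_top"
    if [measurable]: "g \<in> borel_measurable borel" and "\<And>x. \<bar>g x\<bar> \<le> b" for g :: "real ^ 'n::_ \<Rightarrow> real" and b
  proof -
    have "\<forall>\<^sub>F k in at_top. integral\<^sup>L (?d k) g = (\<integral>x. scaled_density k x * g x \<partial>lborel)"
      using eventually_gt_at_top[of 0] by eventually_elim (rule I; measurable)
    then show ?thesis unfolding I'[OF that(1)]
      using scaled_integral_tendsto(2)[OF that] by (simp add: tendsto_cong)
  qed
  \<comment> \<open>Every law has mass 1 because \<open>M k\<close> is a probability space. The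
    constant function 1 is an admissible test function, so no mass is lost in the limit.\<close>
  have "(\<integral>x. limit_fun x \<partial>lborel) = 1"
  proof -
    have "\<forall>\<^sub>F k in at_top. integral\<^sup>L (?d k) (\<lambda>_. 1) = (1::real)"
      using eventually_gt_at_top[of 0]
    proof eventually_elim
      case (elim k)
      have "X k \<in> measurable (M k) (restrict_space lborel weyl_chamber)"
        using assms(4)[OF elim] by (simp add: distributed_def)
      then have "X k \<in> borel_measurable (M k)"
        by (simp add: measurable_restrict_space2_iff)
      then have "(\<lambda>\<omega>. rescaling z k (X k \<omega>)) \<in> borel_measurable (M k)"
        unfolding rescaling_eq_stretch by measurable
      then interpret P: prob_space "?d k"
        by (rule prob_space.prob_space_distr[OF assms(3)[OF elim]])
      show ?case using P.prob_space by simp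
    qed
    then have "((\<lambda>k. integral\<^sup>L (?d k) (\<lambda>_. 1)) \<longlongrightarrow> (1::real)) at_top"
      by (simp add: tendsto_cong)
    moreover have "((\<lambda>k. integral\<^sup>L (?d k) (\<lambda>_. 1)) \<longlongrightarrow> integral\<^sup>L \<mu> (\<lambda>_. 1 :: real)) at_top"
      by (rule conv[where b = 1]) auto
    ultimately have "integral\<^sup>L \<mu> (\<lambda>_. 1 :: real) = 1"
      by (intro tendsto_unique[of at_top]) auto
    moreover have "integral\<^sup>L \<mu> (\<lambda>_. 1 :: real) = (\<integral>x. limit_fun x * 1 \<partial>lborel)"
      by (rule I') simp
    ultimately show ?thesis by simp
  qed
  moreover have "integrable lborel limit_fun"
    using scaled_integral_tendsto(1)[of "\<lambda>_. 1" 1] by simp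
  ultimately have "(\<integral>\<^sup>+x. ennreal (limit_fun x) \<partial>lborel) = 1"
    using limit_fun_nonneg by (subst nn_integral_eq_integral) auto
  then have "emeasure \<mu> (space \<mu>) = 1"
    by (simp add: \<mu>_def emeasure_density)
  then have prob: "prob_space \<mu>" by (rule prob_spaceI)
  have "topological_support \<mu> = half_space z"
  proof (intro set_eqI iffI)
    fix x assume x: "x \<in> topological_support \<mu>"
    show "x \<in> half_space z"
    proof (rule ccontr)
      assume "x \<notin> half_space z"
      let ?U = "{y. y \<bullet> z < 0}"
      have "open ?U" by (intro open_Collect_less continuous_intros)
      moreover have "x \<in> ?U" using \<open>x \<notin> half_space z\<close> by (simp add: half_space_def)
      ultimately have "emeasure \<mu> ?U > 0" using x by (simp add: topological_support_def)
      moreover have "emeasure \<mu> ?U = (\<integral>\<^sup>+y. ennreal (limit_fun y) * indicator ?U y \<partial>lborel)"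
        using \<open>open ?U\<close> by (simp add: \<mu>_def emeasure_density)
      moreover have "\<dots> = (\<integral>\<^sup>+y. 0 \<partial>(lborel :: (real ^ 'n::_) measure))"
        by (intro nn_integral_cong) (auto simp: indicator_def limit_fun_outside)
      ultimately show False by simp
    qed
  next
    fix x assume "x \<in> half_space z"
    then have x: "x \<bullet> z \<ge> 0" by (simp add: half_space_def)
    show "x \<in> topological_support \<mu>"
      unfolding topological_support_def
    proof (intro CollectI allI impI)
      fix U :: "(real ^ 'n::_) set" assume U: "open U" "x \<in> U"
      let ?V = "U \<inter> {y. y \<bullet> z > 0}"
      have "open {y. y \<bullet> z > 0}" by (intro open_Collect_less continuous_intros)
      then have V: "open ?V" using U by blast
      have "?V \<noteq> {}"
      proof -
        \<comment> \<open>Points of the bounding hyperplane belong to the support as well: a small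
          step in the direction \<open>z\<close> enters the open half space without leaving
          \<open>U\<close>.\<close>
        have "((\<lambda>t::real. x + t *\<^sub>R z) \<longlongrightarrow> x + 0 *\<^sub>R z) (at_right 0)"
          by (intro tendsto_intros)
        then have "\<forall>\<^sub>F t in at_right 0. x + t *\<^sub>R z \<in> U"
          using U by (intro topological_tendstoD) auto
        then have "\<forall>\<^sub>F t in at_right 0. x + t *\<^sub>R z \<in> ?V"
          using eventually_at_right_less[of 0]
        proof eventually_elim
          case (elim t)
          have "(x + t *\<^sub>R z) \<bullet> z = x \<bullet> z + t * d" by (simp add: inner_add_left norm_zeros_d)
          moreover have "t * d > 0" using elim de_pos by simp
          ultimately show ?case using elim x by simp
        qed
        then obtain t where "x + t *\<^sub>R z \<in> ?V"
          using eventually_happens'[OF trivial_limit_at_right_real] by blast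
        then show ?thesis by blast
      qed
      \<comment> \<open>The density is strictly positive on \<open>?V\<close>, so a
        \<open>\<mu>\<close>-null \<open>?V\<close> would be a Lebesgue null set, which a nonempty
        open set is not.\<close>
      have "emeasure \<mu> ?V \<noteq> 0"
      proof
        assume "emeasure \<mu> ?V = 0"
        then have I0: "(\<integral>\<^sup>+y. ennreal (limit_fun y) * indicator ?V y \<partial>lborel) = 0"
          using V by (simp add: \<mu>_def emeasure_density)
        have "AE y in lborel. ennreal (limit_fun y) * indicator ?V y = 0"
        proof -
          have [measurable]: "?V \<in> sets borel" using V by (rule borel_open)
          have "(\<lambda>y. ennreal (limit_fun y) * indicator ?V y) \<in> borel_measurable lborel" by measurable
          then show ?thesis using I0 by (simp only: nn_integral_0_iff_AE)
        qed
        then have "AE y in lborel. y \<notin> ?V"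
        proof eventually_elim
          case (elim y)
          show ?case
          proof
            assume "y \<in> ?V"
            moreover from this have "limit_fun y > 0" by (simp add: limit_fun_pos)
            ultimately show False using elim by (simp add: ennreal_eq_0_iff)
          qed
        qed
        then have "?V \<in> null_sets lborel"
          using V by (subst AE_iff_null_sets) auto
        then show False using open_not_negligible[OF V \<open>?V \<noteq> {}\<close>] V
          by (simp add: negligible_iff_null_sets null_sets_completion_iff)
      qed
      moreover have "emeasure \<mu> ?V \<le> emeasure \<mu> U"
        using U by (intro emeasure_mono) (auto simp: \<mu>_def)
      ultimately show "emeasure \<mu> U > 0"
        by (metis le_zero_eq not_gr_zero)
    qed
  qed
  moreover have "converges_in_distribution M (\<lambda>k \<omega>. rescaling z k (X k \<omega>)) \<mu> at_top"
    unfolding converges_in_distribution_def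
  proof (intro allI impI)
    fix g :: "real ^ 'n::_ \<Rightarrow> real"
    assume g: "continuous_on UNIV g" and "bounded (range g)"
    then obtain b where "\<And>x. \<bar>g x\<bar> \<le> b" unfolding bounded_iff by auto
    then show "((\<lambda>k. integral\<^sup>L (?d k) g) \<longlongrightarrow> integral\<^sup>L \<mu> g) at_top"
      using g by (intro conv borel_measurable_continuous_onI)
  qed
  moreover have "sets \<mu> = sets borel" by (simp add: \<mu>_def)
  moreover have "\<mu> = density lborel (\<lambda>y. ennreal (indicator (interior (half_space z)) y * limit_density z y))"
    by (simp add: \<mu>_def limit_fun_def)
  ultimately show ?thesis using prob by blast
qed

end
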